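(* The class of $(\overline{P_1+P_3},\,P_1+S_{1,1,2})$-free graphs has bounded clique-width.
   Context: All graphs are finite, simple and undirected. For a family of graphs $\{H_1,\ldots,H_p\}$, a graph $G$ is $(H_1,\ldots,H_p)$-free if no induced subgraph of $G$ is isomorphic to any $H_i$. $P_r$ denotes the path on $r$ vertices; $G+H$ denotes the disjoint union of $G$ and $H$; $\overline{G}$ denotes the complement of $G$ (so $\overline{P_1+P_3}$ is the "paw": a triangle with a pendant vertex). For $1\le i\le j\le k$, $S_{i,j,k}$ is the tree that has exactly one vertex $x$ of degree $3$ and exactly three leaves, which are at distances $i$, $j$ and $k$ from $x$. The clique-width $\mathrm{cw}(G)$ of a graph $G$ is the minimum number of labels needed to construct $G$ using the operations: create a single vertex with label $i$; take the disjoint union of two labelled graphs; add all edges between vertices labelled $i$ and vertices labelled $j$ ($i\neq j$); rename label $i$ to $j$. A class of graphs has bounded clique-width if there is a constant $c$ such that every graph in the class has clique-width at most $c$. *)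

theory Defs
  imports "Graph_Theory.Digraph_Component" "Graph_Theory.Digraph_Isomorphism"
begin

text \<open>
  A finite simple undirected graph is a \<^const>\<open>pair_graph\<close>: a finite vertex set together with a
  symmetric irreflexive arc relation, an edge being represented by its two opposite arcs.
\<close>

subsection \<open>Operations on graphs, and induced subgraphs\<close>

definition graph_complement :: "'a pair_pre_digraph \<Rightarrow> 'a pair_pre_digraph" where
  "graph_complement G =
    \<lparr> pverts = pverts G,
      parcs = {(u, v). u \<in> pverts G \<and> v \<in> pverts G \<and> u \<noteq> v \<and> (u, v) \<notin> parcs G} \<rparr>"

definition disjoint_union ::
    "'a pair_pre_digraph \<Rightarrow> 'b pair_pre_digraph \<Rightarrow> ('a + 'b) pair_pre_digraph" where
  "disjoint_union G H =
    \<lparr> pverts = pverts G <+> pverts H,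
      parcs = map_prod Inl Inl ` parcs G \<union> map_prod Inr Inr ` parcs H \<rparr>"

definition induced_free :: "'b pair_pre_digraph \<Rightarrow> 'a pair_pre_digraph \<Rightarrow> bool" where
  "induced_free H G \<longleftrightarrow>
    \<not> (\<exists>K. induced_subgraph K (with_proj G) \<and> digraph_iso K (with_proj H))"


subsection \<open>Paths and the trees \<open>S\<^sub>i\<^sub>,\<^sub>j\<^sub>,\<^sub>k\<close>\<close>

definition path_graph :: "nat \<Rightarrow> nat pair_pre_digraph" where
  "path_graph r =
    \<lparr> pverts = {..<r},
      parcs = {(u, v). u < r \<and> v < r \<and> (v = Suc u \<or> u = Suc v)} \<rparr>"

text \<open>
  The vertex of degree 3 is \<open>(0, 0)\<close>; the vertex at distance \<open>d \<ge> 1\<close> from it on the leg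
  \<open>l \<in> {1, 2, 3}\<close> is \<open>(l, d)\<close>, and the legs have lengths \<open>i\<close>, \<open>j\<close> and \<open>k\<close>.
\<close>

definition S_graph :: "nat \<Rightarrow> nat \<Rightarrow> nat \<Rightarrow> (nat \<times> nat) pair_pre_digraph" where
  "S_graph i j k =
    (let V = {(0, 0)} \<union> {1} \<times> {1..i} \<union> {2} \<times> {1..j} \<union> {3} \<times> {1..k};
         E = {((0, 0), (l, 1)) | l. True} \<union> {((l, d), (l, Suc d)) | l d. 1 \<le> d}
     in \<lparr> pverts = V, parcs = (E \<union> E\<inverse>) \<inter> V \<times> V \<rparr>)"


subsection \<open>Clique-width\<close>

text \<open>
  In \<open>Join i j s\<close> all edges between label \<open>i\<close> and label \<open>j\<close> are added; \<open>Relabel i j s\<close> renames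
  label \<open>i\<close> to \<open>j\<close>. The set functions \<open>cw_verts\<close> and \<open>cw_labels\<close> collect the created vertices and
  all labels mentioned in an expression.
\<close>

datatype (cw_verts: 'a, cw_labels: 'l) cw_expr =
    Vertex 'l 'a
  | Disj "('a, 'l) cw_expr" "('a, 'l) cw_expr"
  | Join 'l 'l "('a, 'l) cw_expr"
  | Relabel 'l 'l "('a, 'l) cw_expr"

primrec cw_label :: "('a, 'l) cw_expr \<Rightarrow> 'a \<Rightarrow> 'l" where
  "cw_label (Vertex i u) v = i"
| "cw_label (Disj s t) v = (if v \<in> cw_verts s then cw_label s v else cw_label t v)"
| "cw_label (Join i j s) v = cw_label s v"
| "cw_label (Relabel i j s) v = (if cw_label s v = i then j else cw_label s v)"

primrec cw_arcs :: "('a, 'l) cw_expr \<Rightarrow> 'a rel" where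
  "cw_arcs (Vertex i u) = {}"
| "cw_arcs (Disj s t) = cw_arcs s \<union> cw_arcs t"
| "cw_arcs (Join i j s) =
    (let I = {v \<in> cw_verts s. cw_label s v = i}; J = {v \<in> cw_verts s. cw_label s v = j}
     in cw_arcs s \<union> I \<times> J \<union> J \<times> I)"
| "cw_arcs (Relabel i j s) = cw_arcs s"

primrec cw_valid :: "('a, 'l) cw_expr \<Rightarrow> bool" where
  "cw_valid (Vertex i u) \<longleftrightarrow> True"
| "cw_valid (Disj s t) \<longleftrightarrow> cw_valid s \<and> cw_valid t \<and> cw_verts s \<inter> cw_verts t = {}"
| "cw_valid (Join i j s) \<longleftrightarrow> cw_valid s \<and> i \<noteq> j"
| "cw_valid (Relabel i j s) \<longleftrightarrow> cw_valid s"

definition cw_graph :: "('a, 'l) cw_expr \<Rightarrow> 'a pair_pre_digraph" where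
  "cw_graph s = \<lparr> pverts = cw_verts s, parcs = cw_arcs s \<rparr>"

text \<open>
  No expression builds the graph without vertices; its clique-width is set to 0. Every other graph
  has an expression, see \<open>ex_cw_expr\<close> below.
\<close>

definition clique_width :: "'a pair_pre_digraph \<Rightarrow> nat" where
  "clique_width G =
    (if pverts G = {} then 0
     else LEAST k. \<exists>s :: ('a, nat) cw_expr. cw_valid s \<and> cw_graph s = G \<and> card (cw_labels s) = k)"

definition bounded_clique_width :: "'a pair_pre_digraph set \<Rightarrow> bool" where
  "bounded_clique_width \<G> \<longleftrightarrow> (\<exists>c. \<forall>G\<in>\<G>. clique_width G \<le> c)"

lemma ex_cw_expr_edgeless:
  assumes "finite V" "V \<noteq> {}"
  shows "\<exists>s :: ('a, 'l) cw_expr. cw_valid s \<and> cw_verts s = V \<and> cw_arcs s = {} \<and>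
    (\<forall>v\<in>V. cw_label s v = f v)"
  using assms
proof (induction V rule: finite_ne_induct)
  case (singleton x)
  then show ?case by (intro exI[of _ "Vertex (f x) x"]) auto
next
  case (insert x F)
  then obtain s :: "('a, 'l) cw_expr" where "cw_valid s" "cw_verts s = F" "cw_arcs s = {}"
    "\<forall>v\<in>F. cw_label s v = f v" by blast
  with insert.hyps show ?case by (intro exI[of _ "Disj (Vertex (f x) x) s"]) auto
qed

lemma ex_cw_expr:
  assumes "pair_graph G" "pverts G \<noteq> {}"
  shows "\<exists>s :: ('a, nat) cw_expr. cw_valid s \<and> cw_graph s = G"
proof -
  interpret pair_graph G by fact
  obtain f :: "'a \<Rightarrow> nat" where f: "inj_on f (pverts G)"
    using finite_imp_inj_to_nat_seg[OF pair_finite_verts] by blast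
  have symG: "(v, u) \<in> parcs G" if "(u, v) \<in> parcs G" for u v
    using that pair_sym_arcs unfolding symmetric_def by (auto dest: symD)
  have "\<exists>s :: ('a, nat) cw_expr. cw_valid s \<and> cw_verts s = pverts G \<and> cw_arcs s = A \<union> A\<inverse> \<and>
      (\<forall>v\<in>pverts G. cw_label s v = f v)" if "A \<subseteq> parcs G" for A
    using finite_subset[OF that pair_finite_arcs] that
  proof (induction A rule: finite_induct)
    case empty
    then show ?case using ex_cw_expr_edgeless[OF pair_finite_verts assms(2), of f] by simp
  next
    case (insert e A)
    then obtain s :: "('a, nat) cw_expr" where s: "cw_valid s" "cw_verts s = pverts G"
      "cw_arcs s = A \<union> A\<inverse>" "\<forall>v\<in>pverts G. cw_label s v = f v" by blast
    obtain x y where e: "e = (x, y)" by force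
    have xy: "x \<in> pverts G" "y \<in> pverts G" "x \<noteq> y"
      using insert.prems e pair_no_loops[of e] by (auto dest: in_arcsD1 in_arcsD2)
    have "{v \<in> pverts G. cw_label s v = f x} = {x}" "{v \<in> pverts G. cw_label s v = f y} = {y}"
      using s(4) f xy by (auto dest: inj_onD)
    moreover have "f x \<noteq> f y" using f xy by (auto dest: inj_onD)
    ultimately show ?case using s e by (intro exI[of _ "Join (f x) (f y) s"]) auto
  qed
  from this[OF subset_refl] obtain s :: "('a, nat) cw_expr" where
    s: "cw_valid s" "cw_verts s = pverts G" "cw_arcs s = parcs G \<union> (parcs G)\<inverse>" by blast
  moreover have "parcs G \<union> (parcs G)\<inverse> = parcs G" using symG by auto
  ultimately show ?thesis by (intro exI[of _ s]) (simp add: cw_graph_def)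
qed

end

theory Submission
  imports Defs
begin

text \<open>
  Clique-width is controlled by layouts: binary trees over the vertices in which every node
  induces boundedly many distinct neighbourhoods outside of its vertex set. The existence of such
  layouts is insensitive to adding pendant vertices and twins, to disjoint unions, to deleting
  boundedly many vertices, and to flipping the adjacency between boundedly many vertex classes.

  A connected paw-free graph is complete multipartite or triangle-free, so let the graph be
  triangle-free. If it contains an induced chair \<open>S\<^sub>1\<^sub>,\<^sub>1\<^sub>,\<^sub>2\<close>, then the chair dominates it; with
  all degrees at most 6 the graph is then bounded. Without a chair, every component has maximum
  degree at most 2 or is almost complete bipartite.

  It remains to treat a vertex \<open>v\<close> of maximum degree at least 7. Let \<open>A\<close> be its neighbourhood and
  \<open>B\<close> the set of its non-neighbours, which induces a chair-free graph. Chairs centred at \<open>v\<close> show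
  that non-adjacent vertices of \<open>B\<close> have equal neighbourhoods in \<open>A\<close> or at most one common
  non-neighbour in \<open>A\<close>. Hence the poor vertices of \<open>B\<close>, which see at most half of \<open>A\<close>, have at
  most five neighbourhoods in \<open>A\<close>, while the non-edges between \<open>A\<close> and the rich vertices form, up
  to twins, stars, paths and cycles. A vertex of \<open>B\<close> that sees nothing of \<open>A\<close> is adjacent to
  precisely those rich vertices that miss at least two vertices of \<open>A\<close>, with at most two
  exceptions since \<open>v\<close> has maximum degree. After deleting \<open>v\<close> and the exceptions and flipping
  boundedly many classes, the graph is the disjoint union of a chair-free graph on part of \<open>B\<close> and
  of a graph that reduces to maximum degree 2 by removing pendant vertices and twins.
\<close>

section \<open>Layouts\<close>

definition nbhd :: "'a set \<Rightarrow> ('a \<Rightarrow> 'a \<Rightarrow> bool) \<Rightarrow> 'a \<Rightarrow> 'a set" where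
  "nbhd V E u = {w \<in> V. E u w}"

text \<open>Not counting the empty neighbourhood lets pendant vertices be added at no cost.\<close>

definition ext_nbhds :: "'a set \<Rightarrow> ('a \<Rightarrow> 'a \<Rightarrow> bool) \<Rightarrow> 'a set \<Rightarrow> 'a set set" where
  "ext_nbhds V E X = nbhd (V - X) E ` X - {{}}"

inductive layout :: "'a set \<Rightarrow> ('a \<Rightarrow> 'a \<Rightarrow> bool) \<Rightarrow> nat \<Rightarrow> 'a set \<Rightarrow> bool" for V E k where
  layout_single: "v \<in> V \<Longrightarrow> layout V E k {v}"
| layout_join: "layout V E k X \<Longrightarrow> layout V E k Y \<Longrightarrow> X \<inter> Y = {} \<Longrightarrow>
    card (ext_nbhds V E (X \<union> Y)) \<le> k \<Longrightarrow> layout V E k (X \<union> Y)"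

definition layout_width_le :: "'a set \<Rightarrow> ('a \<Rightarrow> 'a \<Rightarrow> bool) \<Rightarrow> nat \<Rightarrow> bool" where
  "layout_width_le V E k \<longleftrightarrow> V = {} \<or> layout V E k V"

lemma mem_nbhd_iff [simp]: "w \<in> nbhd V E u \<longleftrightarrow> w \<in> V \<and> E u w"
  by (simp add: nbhd_def)

lemma nbhd_subset: "nbhd V E u \<subseteq> V"
  by auto

lemma nbhd_mono: "U \<subseteq> V \<Longrightarrow> nbhd U E u \<subseteq> nbhd V E u"
  by auto

lemma finite_nbhd [simp]: "finite V \<Longrightarrow> finite (nbhd V E u)"
  by (simp add: nbhd_def)

lemma card_nbhd_mono: "finite V \<Longrightarrow> U \<subseteq> V \<Longrightarrow> card (nbhd U E u) \<le> card (nbhd V E u)"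
  by (intro card_mono nbhd_mono finite_nbhd)

lemma finite_ext_nbhds: "finite X \<Longrightarrow> finite (ext_nbhds V E X)"
  by (simp add: ext_nbhds_def)

lemma ext_nbhds_cong:
  assumes "\<And>x. x \<in> X \<Longrightarrow> nbhd (V - X) E x = nbhd (V' - X) E' x"
  shows "ext_nbhds V E X = ext_nbhds V' E' X"
  using assms by (simp add: ext_nbhds_def cong: image_cong_simp)

lemma card_ext_nbhds_le_card:
  assumes "finite X"
  shows "card (ext_nbhds V E X) \<le> card X"
proof -
  have "card (ext_nbhds V E X) \<le> card (nbhd (V - X) E ` X)"
    using assms by (auto simp: ext_nbhds_def intro!: card_mono)
  also have "\<dots> \<le> card X" using assms by (rule card_image_le)
  finally show ?thesis .
qed

lemma layout_subset: "layout V E k X \<Longrightarrow> X \<subseteq> V"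
  by (induction rule: layout.induct) auto

lemma layout_finite: "layout V E k X \<Longrightarrow> finite X"
  by (induction rule: layout.induct) auto

lemma layout_transfer:
  assumes "layout V E k X" and "V \<subseteq> V'"
    and "\<And>Z. Z \<subseteq> V \<Longrightarrow> finite Z \<Longrightarrow> card (ext_nbhds V E Z) \<le> k \<Longrightarrow> card (ext_nbhds V' E' Z) \<le> l"
  shows "layout V' E' l X"
  using assms(1)
proof (induction rule: layout.induct)
  case (layout_single v)
  then show ?case using assms(2) by (blast intro: layout.layout_single)
next
  case (layout_join X Y)
  then have "card (ext_nbhds V' E' (X \<union> Y)) \<le> l"
    by (intro assms(3)) (auto dest: layout_subset layout_finite)
  with layout_join show ?case by (blast intro: layout.layout_join)
qed

lemma layout_width_le_mono: "layout_width_le V E k \<Longrightarrow> k \<le> l \<Longrightarrow> layout_width_le V E l"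
  unfolding layout_width_le_def by (blast intro: layout_transfer le_trans)

lemma layout_width_le_finite: "layout_width_le V E k \<Longrightarrow> finite V"
  unfolding layout_width_le_def by (blast intro: layout_finite)

lemma layout_width_le_empty [simp]: "layout_width_le {} E k"
  by (simp add: layout_width_le_def)

lemma layout_width_le_singleton [simp]: "layout_width_le {v} E k"
  by (auto simp: layout_width_le_def intro: layout_single)

lemma layout_width_le_cong:
  assumes "layout_width_le V E k" and "\<And>u w. u \<in> V \<Longrightarrow> w \<in> V \<Longrightarrow> E u w \<longleftrightarrow> E' u w"
  shows "layout_width_le V E' k"
proof -
  have "ext_nbhds V E' Z = ext_nbhds V E Z" if "Z \<subseteq> V" for Z
    using that assms(2) by (intro ext_nbhds_cong) (auto simp: subset_iff)
  then show ?thesis using assms(1) unfolding layout_width_le_def by (auto intro: layout_transfer)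
qed

lemma layout_width_le_disjoint_union:
  assumes "layout_width_le U E k" "layout_width_le W E k" "U \<inter> W = {}"
    and no_edge: "\<And>u w. u \<in> U \<Longrightarrow> w \<in> W \<Longrightarrow> \<not> E u w \<and> \<not> E w u"
  shows "layout_width_le (U \<union> W) E k"
proof -
  have "ext_nbhds (U \<union> W) E Z = ext_nbhds U E Z" if "Z \<subseteq> U" for Z
    using that no_edge by (intro ext_nbhds_cong) (auto simp: subset_iff)
  then have U: "layout (U \<union> W) E k X" if "layout U E k X" for X
    using that by (auto intro: layout_transfer)
  have "ext_nbhds (U \<union> W) E Z = ext_nbhds W E Z" if "Z \<subseteq> W" for Z
    using that no_edge by (intro ext_nbhds_cong) (auto simp: subset_iff)
  then have W: "layout (U \<union> W) E k X" if "layout W E k X" for X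
    using that by (auto intro: layout_transfer)
  have "ext_nbhds (U \<union> W) E (U \<union> W) = {}" by (auto simp: ext_nbhds_def)
  then show ?thesis
    using assms(1-3) U W by (auto simp: layout_width_le_def intro: layout_join)
qed

lemma layout_width_le_edgeless:
  assumes "finite V" and "\<And>u w. u \<in> V \<Longrightarrow> w \<in> V \<Longrightarrow> \<not> E u w"
  shows "layout_width_le V E k"
  using assms
proof (induction V rule: finite_induct)
  case (insert x V)
  then have "layout_width_le ({x} \<union> V) E k"
    by (intro layout_width_le_disjoint_union) auto
  then show ?case by simp
qed simp

lemma layout_width_le_card:
  assumes "finite V"
  shows "layout_width_le V E (card V)"
proof -
  have "layout V E (card V) X" if "finite X" "X \<noteq> {}" "X \<subseteq> V" for X
    using that
  proof (induction X rule: finite_ne_induct)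
    case (insert x X)
    have "card (ext_nbhds V E ({x} \<union> X)) \<le> card ({x} \<union> X)"
      using insert.hyps by (intro card_ext_nbhds_le_card) simp
    also have "\<dots> \<le> card V" using insert.prems assms by (intro card_mono) auto
    finally have "layout V E (card V) ({x} \<union> X)"
      using insert by (intro layout_join) (auto intro: layout_single)
    then show ?case by simp
  qed (auto intro: layout_single)
  then show ?thesis using assms by (auto simp: layout_width_le_def)
qed

subsection \<open>Flips\<close>

lemma card_ext_nbhds_flip:
  assumes Z: "Z \<subseteq> V" and fin: "finite V"
    and flip: "\<And>x w. x \<in> V \<Longrightarrow> w \<in> V \<Longrightarrow> x \<noteq> w \<Longrightarrow> E x w \<longleftrightarrow> (E' x w \<noteq> R (c x) w)"
  shows "card (ext_nbhds V E Z) \<le> card (c ` V) * (card (ext_nbhds V E' Z) + 1)"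
proof -
  let ?T = "insert {} (ext_nbhds V E' Z)"
  have finZ: "finite Z" using Z fin by (rule finite_subset)
  define h where "h = (\<lambda>(i, T). {w \<in> V - Z. (w \<in> T) \<noteq> R i w})"
  have "nbhd (V - Z) E x = h (c x, nbhd (V - Z) E' x)" if "x \<in> Z" for x
  proof -
    have "E x w \<longleftrightarrow> (E' x w \<noteq> R (c x) w)" if "w \<in> V - Z" for w
      using that \<open>x \<in> Z\<close> Z by (intro flip) auto
    then show ?thesis by (auto simp: h_def)
  qed
  then have "ext_nbhds V E Z \<subseteq> h ` (c ` V \<times> ?T)"
    using Z by (force simp: ext_nbhds_def)
  then have "card (ext_nbhds V E Z) \<le> card (c ` V \<times> ?T)"
    using fin finZ by (intro surj_card_le) (auto simp: finite_ext_nbhds)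
  also have "{} \<notin> ext_nbhds V E' Z" by (simp add: ext_nbhds_def)
  then have "card (c ` V \<times> ?T) = card (c ` V) * (card (ext_nbhds V E' Z) + 1)"
    using finZ by (simp add: card_cartesian_product finite_ext_nbhds)
  finally show ?thesis .
qed

lemma layout_width_le_flip:
  assumes wd: "layout_width_le V E' k" and card: "card (c ` V) \<le> m"
    and flip: "\<And>x w. x \<in> V \<Longrightarrow> w \<in> V \<Longrightarrow> x \<noteq> w \<Longrightarrow> E x w \<longleftrightarrow> (E' x w \<noteq> R (c x) w)"
  shows "layout_width_le V E (m * (k + 1))"
proof -
  have bound: "card (ext_nbhds V E Z) \<le> m * (k + 1)" if "Z \<subseteq> V" "card (ext_nbhds V E' Z) \<le> k" for Z
  proof -
    have "card (ext_nbhds V E Z) \<le> card (c ` V) * (card (ext_nbhds V E' Z) + 1)"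
      using that(1) layout_width_le_finite[OF wd] flip by (rule card_ext_nbhds_flip)
    also have "\<dots> \<le> m * (k + 1)" using card that(2) by (intro mult_le_mono) auto
    finally show ?thesis .
  qed
  then show ?thesis
    using wd layout_transfer[OF _ subset_refl bound] unfolding layout_width_le_def by blast
qed

lemma layout_width_le_delete:
  assumes S: "finite S" "S \<subseteq> V" "card S \<le> m"
    and wd: "layout_width_le (V - S) E k"
  shows "layout_width_le V E ((m + 1) * 2 ^ m * (k + 1))"
proof -
  define E' where "E' u w \<longleftrightarrow> E u w \<and> u \<notin> S \<and> w \<notin> S" for u w
  have "layout_width_le ((V - S) \<union> S) E' k"
  proof (rule layout_width_le_disjoint_union)
    show "layout_width_le (V - S) E' k"
      by (rule layout_width_le_cong[OF wd]) (auto simp: E'_def)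
    show "layout_width_le S E' k"
      using S(1) by (rule layout_width_le_edgeless) (auto simp: E'_def)
  qed (auto simp: E'_def)
  then have wd': "layout_width_le V E' k" using S(2) by (simp add: Un_absorb2)
  define c where "c u = (if u \<in> S then Some u else None, nbhd S E u)" for u
  have "card (c ` V) \<le> card (insert None (Some ` S) \<times> Pow S)"
    using S(1) by (intro card_mono) (auto simp: c_def)
  also have "\<dots> = (card S + 1) * 2 ^ card S"
    using S(1) by (simp add: card_cartesian_product card_Pow card_image)
  also have "\<dots> \<le> (m + 1) * 2 ^ m" using S(3) by (intro mult_le_mono) auto
  finally have card_c: "card (c ` V) \<le> (m + 1) * 2 ^ m" .
  define R where "R = (\<lambda>(x, T) w. w \<in> T \<or> (\<exists>u. x = Some u \<and> E u w))"
  show ?thesis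
    using wd' card_c
  proof (rule layout_width_le_flip)
    fix x w
    show "E x w \<longleftrightarrow> (E' x w \<noteq> R (c x) w)"
      by (auto simp: E'_def R_def c_def)
  qed
qed

subsection \<open>Components\<close>

definition graph_connected :: "'a set \<Rightarrow> ('a \<Rightarrow> 'a \<Rightarrow> bool) \<Rightarrow> bool" where
  "graph_connected V E \<longleftrightarrow>
    (\<forall>U. U \<subseteq> V \<and> U \<noteq> {} \<and> (\<forall>u\<in>U. nbhd V E u \<subseteq> U) \<longrightarrow> U = V)"

lemma graph_connectedD:
  assumes "graph_connected V E" "U \<subseteq> V" "u \<in> U" "\<And>u w. u \<in> U \<Longrightarrow> w \<in> V \<Longrightarrow> E u w \<Longrightarrow> w \<in> U"
  shows "U = V"
proof -
  have "nbhd V E u \<subseteq> U" if "u \<in> U" for u using assms(4) that by auto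
  with assms(1-3) show ?thesis unfolding graph_connected_def by blast
qed

lemma layout_width_le_components:
  assumes "finite V" "symp E"
    and "\<And>U. U \<subseteq> V \<Longrightarrow> U \<noteq> {} \<Longrightarrow> graph_connected U E \<Longrightarrow> layout_width_le U E k"
  shows "layout_width_le V E k"
  using assms(1,3)
proof (induction V rule: finite_psubset_induct)
  case (psubset V)
  show ?case
  proof (cases "V = {} \<or> graph_connected V E")
    case True
    then show ?thesis using psubset.prems[of V] by (cases "V = {}") auto
  next
    case False
    then obtain U where U: "U \<subseteq> V" "U \<noteq> {}" "U \<noteq> V" and closed: "\<forall>u\<in>U. nbhd V E u \<subseteq> U"
      unfolding graph_connected_def by blast
    have "layout_width_le W E k" if "W \<subset> V" for W
      using that
    proof (rule psubset.IH)
      fix S assume "S \<subseteq> W" "S \<noteq> {}" "graph_connected S E"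
      with that show "layout_width_le S E k" by (intro psubset.prems) auto
    qed
    then have "layout_width_le U E k" "layout_width_le (V - U) E k" using U by blast+
    moreover have "\<not> E u w \<and> \<not> E w u" if "u \<in> U" "w \<in> V - U" for u w
      using that closed assms(2) by (auto simp: subset_iff dest: sympD)
    ultimately have "layout_width_le (U \<union> (V - U)) E k"
      by (intro layout_width_le_disjoint_union) auto
    then show ?thesis using U by (simp add: Un_absorb1)
  qed
qed

subsection \<open>Pendant vertices and twins\<close>

definition pendant :: "'a set \<Rightarrow> ('a \<Rightarrow> 'a \<Rightarrow> bool) \<Rightarrow> 'a \<Rightarrow> 'a \<Rightarrow> bool" where
  "pendant V E t h \<longleftrightarrow> t \<in> V \<and> h \<in> V - {t} \<and> (\<forall>w\<in>V - {t, h}. \<not> E t w)"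

definition twins :: "'a set \<Rightarrow> ('a \<Rightarrow> 'a \<Rightarrow> bool) \<Rightarrow> 'a \<Rightarrow> 'a \<Rightarrow> bool" where
  "twins V E t h \<longleftrightarrow> t \<in> V \<and> h \<in> V - {t} \<and> (\<forall>w\<in>V - {t, h}. E t w \<longleftrightarrow> E h w)"

definition attachable :: "'a set \<Rightarrow> ('a \<Rightarrow> 'a \<Rightarrow> bool) \<Rightarrow> 'a \<Rightarrow> 'a \<Rightarrow> bool" where
  "attachable V E t h \<longleftrightarrow> pendant V E t h \<or> twins V E t h"

definition reducible :: "'a set \<Rightarrow> ('a \<Rightarrow> 'a \<Rightarrow> bool) \<Rightarrow> bool" where
  "reducible V E \<longleftrightarrow> (\<exists>t h. attachable V E t h)"

lemma card_ext_nbhds_insert_attached: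
  assumes "attachable V E t h" "Z \<subseteq> V - {t}" "finite Z" "h \<in> Z"
  shows "card (ext_nbhds V E (insert t Z)) \<le> card (ext_nbhds (V - {t}) E Z)"
proof -
  let ?ext = "nbhd (V - {t} - Z) E"
  have eq: "nbhd (V - insert t Z) E x = ?ext x" for x by auto
  have "?ext t = {} \<or> ?ext t = ?ext h"
    using assms by (auto simp: attachable_def pendant_def twins_def)
  then have "ext_nbhds V E (insert t Z) \<subseteq> ext_nbhds (V - {t}) E Z"
    using \<open>h \<in> Z\<close> by (auto simp: ext_nbhds_def eq)
  then show ?thesis using \<open>finite Z\<close> by (simp add: card_mono finite_ext_nbhds)
qed

lemma card_ext_nbhds_attached:
  assumes att: "attachable V E t h" and sym: "symp E"
    and Z: "Z \<subseteq> V - {t}" "finite Z" "h \<notin> Z"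
  shows "card (ext_nbhds V E Z) \<le> card (ext_nbhds (V - {t}) E Z)"
proof -
  let ?ext = "nbhd (V - {t} - Z) E"
  obtain b where b: "\<And>w. w \<in> V - {t, h} \<Longrightarrow> E t w \<longleftrightarrow> b \<and> E h w" and th: "t \<in> V" "h \<in> V" "h \<noteq> t"
    using att unfolding attachable_def pendant_def twins_def by (elim disjE) auto
  define g where "g T = (if b \<and> h \<in> T then insert t T else T)" for T
  have "nbhd (V - Z) E x = g (?ext x)" if "x \<in> Z" for x
  proof -
    have "E x t \<longleftrightarrow> b \<and> E x h" using b[of x] that Z sym by (auto dest: sympD)
    then show ?thesis using that Z th by (auto simp: g_def)
  qed
  then have "ext_nbhds V E Z = g ` ?ext ` Z - {{}}"
    by (simp add: ext_nbhds_def image_image cong: image_cong_simp)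
  moreover have "g {} = {}" by (simp add: g_def)
  then have "g ` \<T> - {{}} \<subseteq> g ` (\<T> - {{}})" for \<T> by blast
  ultimately have "ext_nbhds V E Z \<subseteq> g ` ext_nbhds (V - {t}) E Z"
    by (simp add: ext_nbhds_def)
  then show ?thesis using Z(2) by (intro surj_card_le finite_ext_nbhds)
qed

lemma layout_attach:
  assumes att: "attachable V E t h" and "symp E" "1 \<le> k" and "layout (V - {t}) E k X"
  shows "layout V E k (if h \<in> X then insert t X else X)"
  using assms(4)
proof (induction rule: layout.induct)
  case (layout_single v)
  have "layout V E k ({h} \<union> {t})"
  proof (rule layout_join)
    have "ext_nbhds V E ({h} \<union> {t}) \<subseteq> {nbhd (V - {t, h}) E h}"
      using att by (auto simp: ext_nbhds_def attachable_def pendant_def twins_def insert_commute)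
    then have "card (ext_nbhds V E ({h} \<union> {t})) \<le> card {nbhd (V - {t, h}) E h}"
      by (rule card_mono[rotated]) simp
    then show "card (ext_nbhds V E ({h} \<union> {t})) \<le> k" using \<open>1 \<le> k\<close> by simp
  qed (use att in \<open>auto simp: attachable_def pendant_def twins_def intro: layout.layout_single\<close>)
  then show ?case
    using layout_single by (auto simp: insert_commute intro: layout.layout_single)
next
  case (layout_join X Y)
  let ?\<phi> = "\<lambda>X. if h \<in> X then insert t X else X"
  have XY: "X \<union> Y \<subseteq> V - {t}" "finite (X \<union> Y)"
    using layout_join.hyps by (auto dest: layout_subset layout_finite)
  then have "card (ext_nbhds V E (?\<phi> (X \<union> Y))) \<le> card (ext_nbhds (V - {t}) E (X \<union> Y))"
    using card_ext_nbhds_insert_attached[OF att XY]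
      card_ext_nbhds_attached[OF att \<open>symp E\<close> XY] by simp
  then have "card (ext_nbhds V E (?\<phi> (X \<union> Y))) \<le> k" using layout_join.hyps by simp
  moreover have eq: "?\<phi> (X \<union> Y) = ?\<phi> X \<union> ?\<phi> Y" and "?\<phi> X \<inter> ?\<phi> Y = {}"
    using XY layout_join.hyps by auto
  ultimately show ?case
    unfolding eq by (intro layout.layout_join layout_join.IH)
qed

lemma layout_width_le_attach:
  assumes att: "attachable V E t h" and "symp E" "1 \<le> k" "layout_width_le (V - {t}) E k"
  shows "layout_width_le V E k"
proof -
  have h: "h \<in> V - {t}" "t \<in> V" using att by (auto simp: attachable_def pendant_def twins_def)
  then have "layout (V - {t}) E k (V - {t})" using assms(4) by (auto simp: layout_width_le_def)
  from layout_attach[OF att assms(2,3) this] show ?thesis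
    using h by (simp add: layout_width_le_def insert_absorb)
qed

lemma layout_width_le_reducible:
  assumes "finite V" "symp E" "1 \<le> k"
    and "\<And>U. U \<subseteq> V \<Longrightarrow> U \<noteq> {} \<Longrightarrow> \<not> reducible U E \<Longrightarrow> layout_width_le U E k"
  shows "layout_width_le V E k"
  using assms(1,4)
proof (induction V rule: finite_psubset_induct)
  case (psubset V)
  show ?case
  proof (cases "reducible V E")
    case True
    then obtain t h where th: "attachable V E t h" by (auto simp: reducible_def)
    then have "V - {t} \<subset> V" by (auto simp: attachable_def pendant_def twins_def)
    then have "layout_width_le (V - {t}) E k"
    proof (rule psubset.IH)
      fix U assume "U \<subseteq> V - {t}" "U \<noteq> {}" "\<not> reducible U E"
      then show "layout_width_le U E k" by (intro psubset.prems) auto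
    qed
    with th assms(2,3) show ?thesis by (rule layout_width_le_attach)
  next
    case False
    then show ?thesis using psubset.prems[of V] by (cases "V = {}") auto
  qed
qed

lemma reducible_if_degree_le_1:
  assumes "finite V" "t \<in> V" "V \<noteq> {t}" "card (nbhd V E t) \<le> 1"
  shows "reducible V E"
proof -
  have unique: "w = w'" if "w \<in> nbhd V E t" "w' \<in> nbhd V E t" for w w'
    using that card_le_Suc0_iff_eq[of "nbhd V E t"] assms(1,4) by auto
  obtain h where h: "h \<in> V - {t}" "\<And>w. w \<in> nbhd V E t - {t} \<Longrightarrow> w = h"
  proof (cases "nbhd V E t \<subseteq> {t}")
    case True
    then show ?thesis using assms(2,3) that by blast
  next
    case False
    then obtain h where "h \<in> nbhd V E t" "h \<noteq> t" by blast
    then show ?thesis using unique by (intro that[of h]) auto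
  qed
  then have "pendant V E t h" using assms(2) by (auto simp: pendant_def)
  then show ?thesis by (auto simp: reducible_def attachable_def)
qed

lemma layout_width_le_one_degenerate:
  assumes "finite V" "symp E"
    and "\<And>U. U \<subseteq> V \<Longrightarrow> U \<noteq> {} \<Longrightarrow> \<exists>t\<in>U. card (nbhd U E t) \<le> 1"
  shows "layout_width_le V E 1"
proof (rule layout_width_le_reducible[OF assms(1,2)])
  fix U assume U: "U \<subseteq> V" "U \<noteq> {}" "\<not> reducible U E"
  obtain t where "t \<in> U" "card (nbhd U E t) \<le> 1" using assms(3) U by blast
  moreover have "finite U" using U(1) assms(1) by (rule finite_subset)
  ultimately have "U = {t}" using U(3) reducible_if_degree_le_1[of U t E] by blast
  then show "layout_width_le U E 1" by simp
qed simp

lemma layout_width_le_degree_le_1: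
  assumes "finite V" "symp E" "\<And>u. u \<in> V \<Longrightarrow> card (nbhd V E u) \<le> 1"
  shows "layout_width_le V E 1"
proof (rule layout_width_le_one_degenerate[OF assms(1,2)])
  fix U assume U: "U \<subseteq> V" "U \<noteq> {}"
  then obtain t where t: "t \<in> U" by blast
  have "card (nbhd U E t) \<le> card (nbhd V E t)" using assms(1) U(1) by (rule card_nbhd_mono)
  also have "\<dots> \<le> 1" using assms(3) t U by blast
  finally show "\<exists>t\<in>U. card (nbhd U E t) \<le> 1" using t by blast
qed

lemma connected_degree_le_2_ex_degree_le_1:
  assumes conn: "graph_connected V E" and fin: "finite V"
    and deg: "\<And>u. u \<in> V \<Longrightarrow> card (nbhd V E u) \<le> 2" and U: "U \<subset> V" "U \<noteq> {}"
  shows "\<exists>t\<in>U. card (nbhd U E t) \<le> 1"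
proof (rule ccontr)
  assume none: "\<not> ?thesis"
  have "nbhd U E u = nbhd V E u" if "u \<in> U" for u
  proof (rule card_seteq)
    show "nbhd U E u \<subseteq> nbhd V E u" using U(1) by (intro nbhd_mono) blast
    have "card (nbhd V E u) \<le> 2" using deg that U(1) by blast
    also have "2 \<le> card (nbhd U E u)" using none that by force
    finally show "card (nbhd V E u) \<le> card (nbhd U E u)" .
  qed (use fin in simp)
  then have "\<forall>u\<in>U. nbhd V E u \<subseteq> U" using nbhd_subset by metis
  then show False using conn U unfolding graph_connected_def by blast
qed

lemma layout_width_le_degree_le_2:
  assumes "finite V" and sym: "symp E" and deg: "\<And>u. u \<in> V \<Longrightarrow> card (nbhd V E u) \<le> 2"
  shows "layout_width_le V E 8"
proof (rule layout_width_le_components[OF assms(1) sym])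
  fix U assume U: "U \<subseteq> V" "U \<noteq> {}" "graph_connected U E"
  then obtain v where v: "v \<in> U" by blast
  have finU: "finite U" using U(1) assms(1) by (rule finite_subset)
  have degU: "card (nbhd U E u) \<le> 2" if "u \<in> U" for u
  proof -
    have "card (nbhd U E u) \<le> card (nbhd V E u)" using assms(1) U(1) by (rule card_nbhd_mono)
    also have "\<dots> \<le> 2" using deg that U(1) by blast
    finally show ?thesis .
  qed
  have "layout_width_le (U - {v}) E 1"
  proof (rule layout_width_le_one_degenerate[OF _ sym])
    fix S assume "S \<subseteq> U - {v}" "S \<noteq> {}"
    then show "\<exists>t\<in>S. card (nbhd S E t) \<le> 1"
      using connected_degree_le_2_ex_degree_le_1[OF U(3) finU degU, of S] v by blast
  qed (use finU in simp)
  then have "layout_width_le U E ((1 + 1) * 2 ^ 1 * (1 + 1))"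
    using v by (intro layout_width_le_delete[of "{v}"]) auto
  then show "layout_width_le U E 8" by simp
qed

section \<open>From layouts to clique-width\<close>

lemma finite_cw_verts [simp]: "finite (cw_verts s)"
  by (induction s) auto

lemma cw_label_in_cw_labels: "u \<in> cw_verts s \<Longrightarrow> cw_label s u \<in> cw_labels s"
  by (induction s) auto

lemma ex_cw_relabel:
  fixes s :: "('a, 'l) cw_expr"
  assumes "finite I" "g ` I \<inter> I = {}" "cw_valid s"
  shows "\<exists>s' :: ('a, 'l) cw_expr. cw_valid s' \<and> cw_verts s' = cw_verts s \<and> cw_arcs s' = cw_arcs s \<and>
    cw_labels s' \<subseteq> cw_labels s \<union> I \<union> g ` I \<and>
    (\<forall>u. cw_label s' u = (if cw_label s u \<in> I then g (cw_label s u) else cw_label s u))"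
  using assms
proof (induction I rule: finite_induct)
  case empty
  then show ?case by (intro exI[of _ s]) auto
next
  case (insert i I)
  then obtain s' :: "('a, 'l) cw_expr" where "cw_valid s'" "cw_verts s' = cw_verts s"
    "cw_arcs s' = cw_arcs s" "cw_labels s' \<subseteq> cw_labels s \<union> I \<union> g ` I"
    "\<forall>u. cw_label s' u = (if cw_label s u \<in> I then g (cw_label s u) else cw_label s u)"
    by (auto simp: disjoint_iff)
  with insert.hyps insert.prems show ?case
    by (intro exI[of _ "Relabel i (g i) s'"]) (auto simp: disjoint_iff)
qed

text \<open>Renaming the labels one after the other could merge classes, so all of them are first moved to
  the fresh labels \<open>{n..<2 * n}\<close>.\<close>

lemma ex_cw_recolour:
  fixes s :: "('a, nat) cw_expr"
  assumes "cw_valid s" and less: "\<And>u. u \<in> cw_verts s \<Longrightarrow> cw_label s u < n \<and> f u < n"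
    and cong: "\<And>u w. u \<in> cw_verts s \<Longrightarrow> w \<in> cw_verts s \<Longrightarrow> cw_label s u = cw_label s w \<Longrightarrow> f u = f w"
  obtains s' :: "('a, nat) cw_expr" where "cw_valid s'" "cw_verts s' = cw_verts s"
    "cw_arcs s' = cw_arcs s" "cw_labels s' \<subseteq> cw_labels s \<union> {..<2 * n}"
    "\<And>u. u \<in> cw_verts s \<Longrightarrow> cw_label s' u = f u"
proof -
  define I where "I = cw_label s ` cw_verts s"
  define g where "g i = n + f (inv_into (cw_verts s) (cw_label s) i)" for i
  have g: "g (cw_label s u) = n + f u" if "u \<in> cw_verts s" for u
    using that cong[of "inv_into (cw_verts s) (cw_label s) (cw_label s u)" u]
    by (simp add: g_def inv_into_into f_inv_into_f)
  have I: "finite I" "I \<subseteq> {..<n}" and gI: "g ` I \<subseteq> {n..<2 * n}"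
    using less g by (auto simp: I_def)
  obtain s1 :: "('a, nat) cw_expr" where s1: "cw_valid s1" "cw_verts s1 = cw_verts s"
    "cw_arcs s1 = cw_arcs s" "cw_labels s1 \<subseteq> cw_labels s \<union> I \<union> g ` I"
    "\<And>u. u \<in> cw_verts s \<Longrightarrow> cw_label s1 u = n + f u"
  proof -
    have "g ` I \<inter> I = {}" using I(2) gI by fastforce
    from ex_cw_relabel[OF I(1) this assms(1)] show ?thesis
      using that g by (auto simp: I_def)
  qed
  let ?J = "g ` I" and ?h = "\<lambda>i. i - n"
  have "?h ` ?J \<subseteq> {..<n}" using gI by fastforce
  then have "?h ` ?J \<inter> ?J = {}" using gI by fastforce
  from ex_cw_relabel[OF finite_imageI[OF I(1)] this s1(1)]
  obtain s2 :: "('a, nat) cw_expr" where s2: "cw_valid s2" "cw_verts s2 = cw_verts s1"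
    "cw_arcs s2 = cw_arcs s1" "cw_labels s2 \<subseteq> cw_labels s1 \<union> ?J \<union> ?h ` ?J"
    "\<And>u. cw_label s2 u = (if cw_label s1 u \<in> ?J then cw_label s1 u - n else cw_label s1 u)"
    by auto
  have "cw_label s2 u = f u" if "u \<in> cw_verts s" for u
  proof -
    have "n + f u \<in> ?J" using g[OF that] that unfolding I_def by (metis imageI)
    then show ?thesis using s2(5) s1(5)[OF that] by simp
  qed
  moreover have "cw_labels s2 \<subseteq> cw_labels s \<union> {..<2 * n}"
    using s2(4) s1(4) I(2) gI \<open>?h ` ?J \<subseteq> {..<n}\<close> by fastforce
  ultimately show ?thesis using s1(2,3) s2(1-3) by (intro that[of s2]) auto
qed

lemma ex_cw_joins:
  fixes s :: "('a, 'l) cw_expr"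
  assumes "finite R" "\<forall>i j. (i, j) \<in> R \<longrightarrow> i \<noteq> j" "cw_valid s"
  shows "\<exists>s' :: ('a, 'l) cw_expr. cw_valid s' \<and> cw_verts s' = cw_verts s \<and>
    cw_label s' = cw_label s \<and> cw_labels s' \<subseteq> cw_labels s \<union> fst ` R \<union> snd ` R \<and>
    cw_arcs s' = cw_arcs s \<union> {(u, w). u \<in> cw_verts s \<and> w \<in> cw_verts s \<and>
      ((cw_label s u, cw_label s w) \<in> R \<or> (cw_label s w, cw_label s u) \<in> R)}"
  using assms
proof (induction R rule: finite_induct)
  case empty
  then show ?case by (intro exI[of _ s]) auto
next
  case (insert p R)
  obtain i j where p: "p = (i, j)" by force
  have "\<forall>i j. (i, j) \<in> R \<longrightarrow> i \<noteq> j" using insert.prems(1) by blast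
  from insert.IH[OF this insert.prems(2)] obtain s' :: "('a, 'l) cw_expr" where
    "cw_valid s'" "cw_verts s' = cw_verts s"
    "cw_label s' = cw_label s" "cw_labels s' \<subseteq> cw_labels s \<union> fst ` R \<union> snd ` R"
    "cw_arcs s' = cw_arcs s \<union> {(u, w). u \<in> cw_verts s \<and> w \<in> cw_verts s \<and>
      ((cw_label s u, cw_label s w) \<in> R \<or> (cw_label s w, cw_label s u) \<in> R)}"
    by (elim exE conjE)
  with insert.prems p show ?case
    by (intro exI[of _ "Join i j s'"]) (auto simp: Let_def)
qed

lemma ex_cw_bipartite_join:
  fixes s :: "('a, 'l) cw_expr"
  assumes "cw_valid s" and verts: "cw_verts s = X \<union> Y"
    and disj: "cw_label s ` X \<inter> cw_label s ` Y = {}"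
    and cong: "\<And>x x' y y'. \<lbrakk>x \<in> X; x' \<in> X; y \<in> Y; y' \<in> Y; cw_label s x = cw_label s x';
      cw_label s y = cw_label s y'; E x y\<rbrakk> \<Longrightarrow> E x' y'"
  obtains s' :: "('a, 'l) cw_expr" where "cw_valid s'" "cw_verts s' = X \<union> Y"
    "cw_label s' = cw_label s" "cw_labels s' \<subseteq> cw_labels s"
    "cw_arcs s' = cw_arcs s \<union> {(u, w). u \<in> X \<and> w \<in> Y \<and> E u w \<or> w \<in> X \<and> u \<in> Y \<and> E w u}"
proof -
  define R where "R = (\<lambda>(x, y). (cw_label s x, cw_label s y)) ` {(x, y) \<in> X \<times> Y. E x y}"
  have R_iff: "(cw_label s u, cw_label s w) \<in> R \<longleftrightarrow> u \<in> X \<and> w \<in> Y \<and> E u w"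
    if "u \<in> X \<union> Y" "w \<in> X \<union> Y" for u w
  proof
    assume "(cw_label s u, cw_label s w) \<in> R"
    then obtain x y where xy: "x \<in> X" "y \<in> Y" "E x y" "cw_label s x = cw_label s u"
      "cw_label s y = cw_label s w" by (auto simp: R_def)
    then have "u \<in> X" "w \<in> Y" using disj that by (metis UnE disjoint_iff imageI)+
    then show "u \<in> X \<and> w \<in> Y \<and> E u w" using xy cong by blast
  qed (auto simp: R_def)
  have "finite (X \<union> Y)" using verts finite_cw_verts by metis
  then have "finite (X \<times> Y)" by simp
  then have "finite {(x, y) \<in> X \<times> Y. E x y}" by (rule rev_finite_subset) auto
  then have finR: "finite R" by (simp add: R_def)
  have "\<forall>i j. (i, j) \<in> R \<longrightarrow> i \<noteq> j" using disj by (auto simp: R_def)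
  from ex_cw_joins[OF finR this assms(1)]
  obtain s' :: "('a, 'l) cw_expr" where s': "cw_valid s'" "cw_verts s' = X \<union> Y"
    "cw_label s' = cw_label s" "cw_labels s' \<subseteq> cw_labels s \<union> fst ` R \<union> snd ` R"
    "cw_arcs s' = cw_arcs s \<union> {(u, w). u \<in> X \<union> Y \<and> w \<in> X \<union> Y \<and>
      ((cw_label s u, cw_label s w) \<in> R \<or> (cw_label s w, cw_label s u) \<in> R)}"
    unfolding verts by (elim exE conjE)
  have "fst ` R \<union> snd ` R \<subseteq> cw_labels s"
    using cw_label_in_cw_labels[of _ s] by (auto simp: R_def verts)
  then have "cw_labels s' \<subseteq> cw_labels s" using s'(4) by blast
  moreover have "cw_arcs s' = cw_arcs s \<union> {(u, w). u \<in> X \<and> w \<in> Y \<and> E u w \<or> w \<in> X \<and> u \<in> Y \<and> E w u}"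
    unfolding s'(5) using R_iff by blast
  ultimately show ?thesis by (rule that[OF s'(1-3)])
qed

lemma ex_nat_code:
  assumes "finite X" "card (f ` X) \<le> m"
  obtains code :: "'a \<Rightarrow> nat"
  where "\<And>x. x \<in> X \<Longrightarrow> code x < m" "\<And>x y. x \<in> X \<Longrightarrow> y \<in> X \<Longrightarrow> code x = code y \<longleftrightarrow> f x = f y"
proof -
  obtain h where h: "bij_betw h (f ` X) {0..<card (f ` X)}"
    using ex_bij_betw_finite_nat[of "f ` X"] assms(1) by auto
  show ?thesis
  proof (rule that[of "h \<circ> f"])
    show "(h \<circ> f) x < m" if "x \<in> X" for x
      using bij_betwE[OF h] that assms(2) by fastforce
    show "(h \<circ> f) x = (h \<circ> f) y \<longleftrightarrow> f x = f y" if "x \<in> X" "y \<in> X" for x y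
      using bij_betw_imp_inj_on[OF h] that by (auto dest: inj_onD)
  qed
qed

definition layout_expr ::
    "'a set \<Rightarrow> ('a \<Rightarrow> 'a \<Rightarrow> bool) \<Rightarrow> nat \<Rightarrow> nat \<Rightarrow> 'a set \<Rightarrow> ('a, nat) cw_expr \<Rightarrow> bool" where
  "layout_expr V E l n X s \<longleftrightarrow> cw_valid s \<and> cw_verts s = X \<and>
    cw_arcs s = {(u, w). u \<in> X \<and> w \<in> X \<and> E u w} \<and> cw_labels s \<subseteq> {..<l} \<and>
    (\<forall>u\<in>X. cw_label s u < n) \<and>
    (\<forall>u\<in>X. \<forall>w\<in>X. cw_label s u = cw_label s w \<longrightarrow> nbhd (V - X) E u = nbhd (V - X) E w)"

lemma layout_exprD:
  assumes "layout_expr V E l n X s"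
  shows "cw_valid s" "cw_verts s = X" "cw_arcs s = {(u, w). u \<in> X \<and> w \<in> X \<and> E u w}"
    "cw_labels s \<subseteq> {..<l}" "\<And>u. u \<in> X \<Longrightarrow> cw_label s u < n"
    "\<And>u w. u \<in> X \<Longrightarrow> w \<in> X \<Longrightarrow> cw_label s u = cw_label s w \<Longrightarrow> nbhd (V - X) E u = nbhd (V - X) E w"
  using assms unfolding layout_expr_def by blast+

lemma layout_expr_recolour:
  assumes d: "layout_expr V E l n X d" and card: "card (nbhd (V - X) E ` X) \<le> m"
    and "m \<le> n" "2 * n \<le> l"
  shows "\<exists>s. layout_expr V E l m X s"
proof -
  note d' = layout_exprD[OF d]
  have "finite X" using d'(2) finite_cw_verts by metis
  then obtain code :: "'a \<Rightarrow> nat" where code: "\<And>u. u \<in> X \<Longrightarrow> code u < m"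
    "\<And>u w. u \<in> X \<Longrightarrow> w \<in> X \<Longrightarrow> code u = code w \<longleftrightarrow> nbhd (V - X) E u = nbhd (V - X) E w"
    using card by (rule ex_nat_code) auto
  have "cw_label d u < n \<and> code u < n" if "u \<in> X" for u
    using that d'(5) code(1) \<open>m \<le> n\<close> by (meson less_le_trans)
  moreover have "code u = code w" if "u \<in> X" "w \<in> X" "cw_label d u = cw_label d w" for u w
    using d'(6)[OF that] code(2)[OF that(1,2)] by simp
  ultimately obtain s :: "('a, nat) cw_expr" where s: "cw_valid s" "cw_verts s = X"
    "cw_arcs s = cw_arcs d" "cw_labels s \<subseteq> cw_labels d \<union> {..<2 * n}"
    "\<And>u. u \<in> X \<Longrightarrow> cw_label s u = code u"
    by (rule ex_cw_recolour[OF d'(1), unfolded d'(2)]) auto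
  have "cw_labels s \<subseteq> {..<l}" using s(4) d'(4) \<open>2 * n \<le> l\<close> by fastforce
  then have "layout_expr V E l m X s"
    by (simp add: layout_expr_def s(1-3,5) d'(3) code)
  then show ?thesis ..
qed

lemma ex_cw_separated_union:
  fixes s t :: "('a, nat) cw_expr"
  assumes valid: "cw_valid s" "cw_valid t" and disj: "cw_verts s \<inter> cw_verts t = {}"
    and less: "\<And>u. u \<in> cw_verts t \<Longrightarrow> cw_label t u < m"
  obtains d :: "('a, nat) cw_expr" where "cw_valid d" "cw_verts d = cw_verts s \<union> cw_verts t"
    "cw_arcs d = cw_arcs s \<union> cw_arcs t"
    "cw_labels d \<subseteq> cw_labels s \<union> cw_labels t \<union> {..<4 * m}"
    "\<And>u. u \<in> cw_verts s \<Longrightarrow> cw_label d u = cw_label s u"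
    "\<And>u. u \<in> cw_verts t \<Longrightarrow> cw_label d u = m + cw_label t u"
proof -
  have "cw_label t u < 2 * m \<and> m + cw_label t u < 2 * m" if "u \<in> cw_verts t" for u
    using less[OF that] by simp
  then obtain t' :: "('a, nat) cw_expr" where t': "cw_valid t'" "cw_verts t' = cw_verts t"
    "cw_arcs t' = cw_arcs t" "cw_labels t' \<subseteq> cw_labels t \<union> {..<2 * (2 * m)}"
    "\<And>u. u \<in> cw_verts t \<Longrightarrow> cw_label t' u = m + cw_label t u"
    by (rule ex_cw_recolour[OF valid(2)]) auto
  show ?thesis
    by (rule that[of "Disj s t'"]) (use valid t' disj in auto)
qed

lemma adj_if_same_outside_nbhds:
  assumes "symp E" "X \<inter> Y = {}" "X \<union> Y \<subseteq> V"
    and x: "x \<in> X" "x' \<in> X" "nbhd (V - X) E x = nbhd (V - X) E x'"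
    and y: "y \<in> Y" "y' \<in> Y" "nbhd (V - Y) E y = nbhd (V - Y) E y'" and "E x y"
  shows "E x' y'"
proof -
  have "y \<in> nbhd (V - X) E x" using y(1) assms(2,3) \<open>E x y\<close> by auto
  then have "y \<in> nbhd (V - X) E x'" using x(3) by simp
  then have "E y x'" using \<open>symp E\<close> by (auto dest: sympD)
  then have "x' \<in> nbhd (V - Y) E y" using x(2) assms(2,3) by auto
  then have "x' \<in> nbhd (V - Y) E y'" using y(3) by simp
  then show ?thesis using \<open>symp E\<close> by (auto dest: sympD)
qed

lemma layout_expr_disj_join:
  assumes s: "layout_expr V E (4 * m) m X s" and t: "layout_expr V E (4 * m) m Y t"
    and XY: "X \<inter> Y = {}" "X \<union> Y \<subseteq> V" and sym: "symp E"
  shows "\<exists>d. layout_expr V E (4 * m) (2 * m) (X \<union> Y) d"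
proof -
  note s' = layout_exprD[OF s] and t' = layout_exprD[OF t]
  obtain d :: "('a, nat) cw_expr" where d: "cw_valid d" "cw_verts d = X \<union> Y"
    "cw_arcs d = cw_arcs s \<union> cw_arcs t" "cw_labels d \<subseteq> cw_labels s \<union> cw_labels t \<union> {..<4 * m}"
    "\<And>u. u \<in> X \<Longrightarrow> cw_label d u = cw_label s u"
    "\<And>u. u \<in> Y \<Longrightarrow> cw_label d u = m + cw_label t u"
    by (rule ex_cw_separated_union[OF s'(1) t'(1), unfolded s'(2) t'(2), OF XY(1) t'(5)]) auto
  have same: "u \<in> X \<and> w \<in> X \<and> nbhd (V - X) E u = nbhd (V - X) E w \<or>
      u \<in> Y \<and> w \<in> Y \<and> nbhd (V - Y) E u = nbhd (V - Y) E w"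
    if "u \<in> X \<union> Y" "w \<in> X \<union> Y" "cw_label d u = cw_label d w" for u w
    using that d(5,6) s'(5,6) t'(6) by (metis UnE add_left_cancel not_add_less1)
  have "cw_label d ` X \<inter> cw_label d ` Y = {}" using d(5,6) s'(5) by fastforce
  moreover have "E x' y'"
    if "x \<in> X" "x' \<in> X" "y \<in> Y" "y' \<in> Y" "cw_label d x = cw_label d x'"
      "cw_label d y = cw_label d y'" "E x y" for x x' y y'
    using adj_if_same_outside_nbhds[OF sym XY, of x x' y y'] same[of x x'] same[of y y'] that XY(1)
    by blast
  ultimately obtain e :: "('a, nat) cw_expr" where e: "cw_valid e" "cw_verts e = X \<union> Y"
    "cw_label e = cw_label d" "cw_labels e \<subseteq> cw_labels d"
    "cw_arcs e = cw_arcs d \<union> {(u, w). u \<in> X \<and> w \<in> Y \<and> E u w \<or> w \<in> X \<and> u \<in> Y \<and> E w u}"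
    by (rule ex_cw_bipartite_join[OF d(1,2)])
  have "cw_arcs e = {(u, w). u \<in> X \<union> Y \<and> w \<in> X \<union> Y \<and> E u w}"
    unfolding e(5) d(3) s'(3) t'(3) using sympD[OF sym] by blast
  moreover have "cw_labels e \<subseteq> {..<4 * m}" using e(4) d(4) s'(4) t'(4) by blast
  moreover have "cw_label d u < 2 * m" if "u \<in> X \<union> Y" for u
    using that d(5,6) s'(5) t'(5) by fastforce
  moreover have "nbhd (V - (X \<union> Y)) E u = nbhd (V - (X \<union> Y)) E w"
    if uw: "u \<in> X \<union> Y" "w \<in> X \<union> Y" "cw_label d u = cw_label d w" for u w
  proof -
    have "nbhd (V - (X \<union> Y)) E z = nbhd (V - X) E z - Y"
      "nbhd (V - (X \<union> Y)) E z = nbhd (V - Y) E z - X" for z by auto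
    then show ?thesis using same[OF uw] by metis
  qed
  ultimately have "layout_expr V E (4 * m) (2 * m) (X \<union> Y) e"
    unfolding layout_expr_def e(3) using e(1,2) by blast
  then show ?thesis ..
qed

lemma ex_layout_expr:
  assumes "layout V E k X" "symp E" "irreflp E"
  shows "\<exists>s. layout_expr V E (4 * (k + 1)) (k + 1) X s"
  using assms(1)
proof (induction rule: layout.induct)
  case (layout_single v)
  have "layout_expr V E (4 * (k + 1)) (k + 1) {v} (Vertex 0 v)"
    using assms(3) by (auto simp: layout_expr_def dest: irreflpD)
  then show ?case ..
next
  case (layout_join X Y)
  let ?Z = "X \<union> Y"
  have Z: "?Z \<subseteq> V" "finite ?Z"
    using layout_join.hyps by (auto dest: layout_subset layout_finite)
  obtain d where d: "layout_expr V E (4 * (k + 1)) (2 * (k + 1)) ?Z d"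
    using layout_join Z(1) layout_expr_disj_join[OF _ _ _ _ assms(2)] by blast
  have "nbhd (V - ?Z) E ` ?Z \<subseteq> insert {} (ext_nbhds V E ?Z)" by (auto simp: ext_nbhds_def)
  then have "card (nbhd (V - ?Z) E ` ?Z) \<le> card (insert {} (ext_nbhds V E ?Z))"
    using Z(2) by (intro card_mono) (auto simp: finite_ext_nbhds)
  also have "\<dots> \<le> k + 1"
    using layout_join.hyps Z(2) by (simp add: card_insert_if finite_ext_nbhds)
  finally show ?case by (rule layout_expr_recolour[OF d]) auto
qed

abbreviation adj :: "'a pair_pre_digraph \<Rightarrow> 'a \<Rightarrow> 'a \<Rightarrow> bool" where
  "adj G u w \<equiv> (u, w) \<in> parcs G"

lemma pair_graph_adj:
  assumes "pair_graph G"
  shows "symp (adj G)" "irreflp (adj G)"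
proof -
  interpret pair_graph G by fact
  show "symp (adj G)" using pair_sym_arcs by (auto simp: symmetric_def sym_def symp_def)
  show "irreflp (adj G)" using pair_no_loops by (force simp: irreflp_def)
qed

lemma clique_width_le_if_layout_width_le:
  assumes G: "pair_graph G" and wd: "layout_width_le (pverts G) (adj G) k"
  shows "clique_width G \<le> 4 * (k + 1)"
proof (cases "pverts G = {}")
  case False
  interpret pair_graph G by fact
  have "layout (pverts G) (adj G) k (pverts G)" using wd False by (simp add: layout_width_le_def)
  then obtain s where "layout_expr (pverts G) (adj G) (4 * (k + 1)) (k + 1) (pverts G) s"
    using ex_layout_expr pair_graph_adj[OF G] by blast
  note s = layout_exprD[OF this]
  have "cw_arcs s = parcs G" using s(3) in_arcsD1 in_arcsD2 by auto
  then have "cw_graph s = G" using s(2) by (simp add: cw_graph_def)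
  then have "clique_width G \<le> card (cw_labels s)"
    using False s(1) by (auto simp: clique_width_def intro!: Least_le)
  also have "\<dots> \<le> card {..<4 * (k + 1)}" using s(4) by (intro card_mono) auto
  finally show ?thesis by simp
qed (simp add: clique_width_def)

section \<open>Triangle-free graphs without an induced chair\<close>

definition triangle_free :: "'a set \<Rightarrow> ('a \<Rightarrow> 'a \<Rightarrow> bool) \<Rightarrow> bool" where
  "triangle_free V E \<longleftrightarrow> (\<forall>a b c. {a, b, c} \<subseteq> V \<longrightarrow> \<not> (E a b \<and> E b c \<and> E a c))"

definition chair :: "('a \<Rightarrow> 'a \<Rightarrow> bool) \<Rightarrow> 'a \<Rightarrow> 'a \<Rightarrow> 'a \<Rightarrow> 'a \<Rightarrow> 'a \<Rightarrow> bool" where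
  "chair E x a b c d \<longleftrightarrow> E x a \<and> E x b \<and> E x c \<and> E c d \<and> a \<noteq> b \<and>
    \<not> E a b \<and> \<not> E a c \<and> \<not> E b c \<and> \<not> E x d \<and> \<not> E a d \<and> \<not> E b d"

definition chair_free :: "'a set \<Rightarrow> ('a \<Rightarrow> 'a \<Rightarrow> bool) \<Rightarrow> bool" where
  "chair_free V E \<longleftrightarrow> (\<forall>x a b c d. {x, a, b, c, d} \<subseteq> V \<longrightarrow> \<not> chair E x a b c d)"

lemma triangle_free_subset: "triangle_free V E \<Longrightarrow> U \<subseteq> V \<Longrightarrow> triangle_free U E"
  unfolding triangle_free_def by (meson subset_trans)

lemma chair_free_subset: "chair_free V E \<Longrightarrow> U \<subseteq> V \<Longrightarrow> chair_free U E"
  unfolding chair_free_def by (meson subset_trans)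

lemma ex_three_of_card_ge_3:
  assumes "3 \<le> card S"
  obtains a b c where "a \<in> S" "b \<in> S" "c \<in> S" "a \<noteq> b" "a \<noteq> c" "b \<noteq> c"
proof -
  obtain T where T: "T \<subseteq> S" "card T = 3" using assms obtain_subset_with_card_n by metis
  from T(2) obtain a b c where "T = {a, b, c}" "a \<noteq> b" "a \<noteq> c" "b \<noteq> c"
    unfolding card_3_iff by (elim exE conjE)
  then show ?thesis using T(1) by (intro that[of a b c]) auto
qed

lemma card_le_2_if_no_three:
  assumes "finite S" "\<And>a b c. a \<in> S \<Longrightarrow> b \<in> S \<Longrightarrow> c \<in> S \<Longrightarrow> a = b \<or> a = c \<or> b = c"
  shows "card S \<le> 2"
proof (rule ccontr)
  assume "\<not> card S \<le> 2"
  then have "3 \<le> card S" by simp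
  then obtain a b c where "a \<in> S" "b \<in> S" "c \<in> S" "a \<noteq> b" "a \<noteq> c" "b \<noteq> c"
    by (rule ex_three_of_card_ge_3)
  then show False using assms(2) by blast
qed

lemma card_le_1_if_unique: "finite S \<Longrightarrow> (\<And>a b. a \<in> S \<Longrightarrow> b \<in> S \<Longrightarrow> a = b) \<Longrightarrow> card S \<le> 1"
  by (simp add: card_le_Suc0_iff_eq)

locale simple_graph =
  fixes V :: "'a set" and E :: "'a \<Rightarrow> 'a \<Rightarrow> bool"
  assumes finite_V: "finite V" and symp_E: "symp E" and irreflp_E: "irreflp E"
begin

lemma adj_commute: "E u w \<longleftrightarrow> E w u"
  using symp_E by (metis sympD)

lemma not_adj_self [simp]: "\<not> E u u"
  using irreflp_E by (rule irreflpD)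

lemma simple_graph_subset: "U \<subseteq> V \<Longrightarrow> simple_graph U E"
  using finite_V symp_E irreflp_E by unfold_locales (rule finite_subset)

end

locale triangle_free_graph = simple_graph +
  assumes triangle_free: "triangle_free V E"
begin

lemma not_adj_if_common_nbr:
  assumes "u \<in> V" "v \<in> V" "w \<in> V" "E u v" "E u w"
  shows "\<not> E v w"
  using triangle_free assms unfolding triangle_free_def by blast

lemma chairI:
  assumes "x \<in> V" "a \<in> V" "b \<in> V" "c \<in> V" "d \<in> V" "E x a" "E x b" "E x c" "E c d"
    "\<not> E a d" "\<not> E b d" "a \<noteq> b"
  shows "chair E x a b c d"
proof -
  have "\<not> E x d" using not_adj_if_common_nbr[of c x d] assms adj_commute by blast
  then show ?thesis using assms not_adj_if_common_nbr[of x] unfolding chair_def by blast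
qed

end

locale chair_free_graph = triangle_free_graph +
  assumes chair_free: "chair_free V E"
begin

lemma chair_leaves_eq:
  assumes "x \<in> V" "a \<in> V" "b \<in> V" "c \<in> V" "d \<in> V"
    and "E x a" "E x b" "E x c" "E c d" "\<not> E a d" "\<not> E b d"
  shows "a = b"
proof (rule ccontr)
  assume "a \<noteq> b"
  with assms have "chair E x a b c d" by (rule chairI)
  then show False using chair_free assms unfolding chair_free_def by blast
qed

end

lemma (in triangle_free_graph) chair_free_graph_subset:
  assumes "U \<subseteq> V" "chair_free U E"
  shows "chair_free_graph U E"
proof -
  interpret simple_graph U E using assms(1) by (rule simple_graph_subset)
  show ?thesis
    using triangle_free_subset[OF triangle_free assms(1)] assms(2) by unfold_locales
qed

text \<open>A vertex \<open>x\<close> of degree at least 3 makes a connected chair-free triangle-free graph almost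
  complete bipartite: the non-edges between the neighbours of \<open>x\<close> and the vertices at distance 0 or
  2 from \<open>x\<close> form a matching, and at most one vertex remains.\<close>

locale connected_chair_free_graph = chair_free_graph +
  fixes x
  assumes connected: "graph_connected V E" and x_in_V: "x \<in> V" and degree_x: "3 \<le> card (nbhd V E x)"
begin

definition nbrs where "nbrs = nbhd V E x"
definition opposite where "opposite = {q \<in> V - nbrs. \<exists>p\<in>nbrs. E q p}"
definition remote where "remote = {r \<in> V - nbrs - opposite. \<exists>q\<in>opposite. E r q}"

lemma nbrsD: "p \<in> nbrs \<Longrightarrow> p \<in> V \<and> E x p \<and> E p x"
  using adj_commute by (auto simp: nbrs_def)

lemma oppositeD: "q \<in> opposite \<Longrightarrow> q \<in> V \<and> q \<notin> nbrs"
  by (simp add: opposite_def)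

lemma remoteD:
  assumes "r \<in> remote"
  shows "r \<in> V" "r \<notin> nbrs" "r \<notin> opposite" "\<not> E x r"
  using assms by (auto simp: remote_def nbrs_def)

lemma nbrs_indep: "p \<in> nbrs \<Longrightarrow> p' \<in> nbrs \<Longrightarrow> \<not> E p p'"
  using not_adj_if_common_nbr x_in_V nbrsD by blast

lemma nbrs_remote_nonadj: "p \<in> nbrs \<Longrightarrow> r \<in> remote \<Longrightarrow> \<not> E r p"
  by (auto simp: opposite_def remote_def)

lemma opposite_misses_unique:
  assumes "q \<in> opposite" "p \<in> nbrs" "p' \<in> nbrs" "\<not> E q p" "\<not> E q p'"
  shows "p = p'"
proof -
  obtain c where "c \<in> nbrs" "E q c" using assms(1) by (auto simp: opposite_def)
  then show ?thesis
    using chair_leaves_eq[of x p p' c q] assms nbrsD oppositeD x_in_V adj_commute by blast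
qed

lemma ex_two_common_nbrs:
  assumes "q \<in> opposite"
  obtains p p' where "p \<in> nbrs" "p' \<in> nbrs" "p \<noteq> p'" "E q p" "E q p'"
proof -
  obtain a b c where "a \<in> nbrs" "b \<in> nbrs" "c \<in> nbrs" "a \<noteq> b" "a \<noteq> c" "b \<noteq> c"
    using degree_x unfolding nbrs_def by (rule ex_three_of_card_ge_3)
  then show ?thesis using opposite_misses_unique[OF assms] that by metis
qed

lemma ex_common_nbr:
  assumes "q \<in> opposite" "q' \<in> opposite"
  obtains p where "p \<in> nbrs" "E q p" "E q' p"
  using ex_two_common_nbrs[OF assms(1)] opposite_misses_unique[OF assms(2)] by metis

lemma opposite_indep:
  assumes "q \<in> opposite" "q' \<in> opposite"
  shows "\<not> E q q'"
proof -
  obtain p where "p \<in> nbrs" "E q p" "E q' p" using assms by (rule ex_common_nbr)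
  then show ?thesis
    using not_adj_if_common_nbr[of p q q'] assms nbrsD oppositeD adj_commute by blast
qed

lemma nbr_misses_unique:
  assumes "p \<in> nbrs" "q \<in> opposite" "q' \<in> opposite" "\<not> E p q" "\<not> E p q'"
  shows "q = q'"
proof -
  obtain p' where p': "p' \<in> nbrs" "p' \<noteq> p" using ex_two_common_nbrs[OF assms(2)] by metis
  then have "E q p'" "E q' p'" using opposite_misses_unique assms adj_commute by blast+
  then show ?thesis
    using chair_leaves_eq[of p' q q' x p] assms p' x_in_V nbrsD oppositeD adj_commute by blast
qed

lemma remote_nbr_in_opposite:
  assumes r: "r \<in> remote" and w: "w \<in> V" "E r w"
  shows "w \<in> opposite"
proof (rule ccontr)
  assume "w \<notin> opposite"
  have "w \<notin> nbrs" using r w nbrs_remote_nonadj by blast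
  then have no: "\<not> E p w" if "p \<in> nbrs" for p
    using that \<open>w \<notin> opposite\<close> w adj_commute by (auto simp: opposite_def)
  obtain q where q: "q \<in> opposite" "E r q" using r by (auto simp: remote_def)
  obtain p p' where "p \<in> nbrs" "p' \<in> nbrs" "p \<noteq> p'" "E q p" "E q p'"
    using q(1) by (rule ex_two_common_nbrs)
  then show False
    using chair_leaves_eq[of q p p' r w] no q w r nbrsD oppositeD remoteD(1) adj_commute by blast
qed

lemma V_eq_parts: "V = nbrs \<union> opposite \<union> remote"
proof -
  have "nbrs \<noteq> {}" using degree_x by (auto simp: nbrs_def)
  then obtain p where p: "p \<in> nbrs \<union> opposite \<union> remote" by blast
  have "nbrs \<union> opposite \<union> remote = V"
    using connected _ p
  proof (rule graph_connectedD)
    show "nbrs \<union> opposite \<union> remote \<subseteq> V" by (auto simp: nbrs_def opposite_def remote_def)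
    fix u w assume u: "u \<in> nbrs \<union> opposite \<union> remote" and w: "w \<in> V" "E u w"
    then have "E w u" using adj_commute by blast
    then show "w \<in> nbrs \<union> opposite \<union> remote"
      using u w remote_nbr_in_opposite unfolding opposite_def remote_def by blast
  qed
  then show ?thesis ..
qed

lemma opposite_remote_unique:
  assumes "q \<in> opposite" "r \<in> remote" "r' \<in> remote" "E q r" "E q r'"
  shows "r = r'"
proof -
  obtain p where "p \<in> nbrs" "E q p" using assms(1) by (auto simp: opposite_def)
  then show ?thesis
    using chair_leaves_eq[of q r r' p x] assms x_in_V nbrsD oppositeD remoteD adj_commute by blast
qed

lemma remote_unique:
  assumes r: "r \<in> remote" and r': "r' \<in> remote"
  shows "r = r'"
proof (rule ccontr)
  assume "r \<noteq> r'"
  obtain q q' where q: "q \<in> opposite" "E q r" and q': "q' \<in> opposite" "E q' r'"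
    using r r' adj_commute by (auto simp: remote_def)
  have no: "\<not> E q' r" using opposite_remote_unique[OF q'(1) r' r q'(2)] \<open>r \<noteq> r'\<close> by blast
  obtain p where p: "p \<in> nbrs" "E q p" "E q' p" using q(1) q'(1) by (rule ex_common_nbr)
  have "x = q'"
    using chair_leaves_eq[of p x q' q r] p no q q' r x_in_V nbrsD oppositeD remoteD adj_commute
    by blast
  then show False using q' r' remoteD by blast
qed

lemma layout_width_le_bipartite_part: "layout_width_le (nbrs \<union> opposite) E 4"
proof -
  let ?U = "nbrs \<union> opposite"
  define E' where "E' u w \<longleftrightarrow>
    \<not> E u w \<and> (u \<in> nbrs \<and> w \<in> opposite \<or> u \<in> opposite \<and> w \<in> nbrs)" for u w
  have finU: "finite ?U" using V_eq_parts finite_V by (metis finite_Un)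
  have "layout_width_le ?U E' 1"
  proof (rule layout_width_le_degree_le_1[OF finU])
    show "symp E'" using adj_commute by (auto simp: E'_def symp_def)
    fix u
    have "w = w'" if "E' u w" "E' u w'" for w w'
      using that opposite_misses_unique nbr_misses_unique oppositeD unfolding E'_def by blast
    then show "card (nbhd ?U E' u) \<le> 1"
      using finU by (intro card_le_1_if_unique) auto
  qed
  moreover have "card ((\<lambda>u. u \<in> nbrs) ` ?U) \<le> card (UNIV :: bool set)"
    by (intro card_mono) auto
  then have "card ((\<lambda>u. u \<in> nbrs) ` ?U) \<le> 2" by simp
  ultimately have "layout_width_le ?U E (2 * (1 + 1))"
  proof (rule layout_width_le_flip)
    fix u w assume "u \<in> ?U" "w \<in> ?U"
    then show "E u w \<longleftrightarrow> (E' u w \<noteq> (if u \<in> nbrs then w \<in> opposite else w \<in> nbrs))"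
      using nbrs_indep opposite_indep oppositeD by (auto simp: E'_def)
  qed
  then show ?thesis by simp
qed

lemma layout_width_le_connected: "layout_width_le V E 20"
proof -
  have "finite remote" using finite_V by (simp add: remote_def)
  moreover have "card remote \<le> 1" using \<open>finite remote\<close> remote_unique by (rule card_le_1_if_unique)
  moreover have "remote \<subseteq> V" "V - remote = nbrs \<union> opposite" using V_eq_parts remoteD by blast+
  ultimately have "layout_width_le V E ((1 + 1) * 2 ^ 1 * (4 + 1))"
    using layout_width_le_bipartite_part by (intro layout_width_le_delete) auto
  then show ?thesis by simp
qed

end

lemma (in chair_free_graph) layout_width_le_chair_free: "layout_width_le V E 20"
proof (rule layout_width_le_components[OF finite_V symp_E])
  fix U assume U: "U \<subseteq> V" "graph_connected U E"
  interpret U: chair_free_graph U E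
    using U(1) chair_free_subset[OF chair_free U(1)] by (rule chair_free_graph_subset)
  show "layout_width_le U E 20"
  proof (cases "\<exists>x\<in>U. 3 \<le> card (nbhd U E x)")
    case True
    then obtain x where "x \<in> U" "3 \<le> card (nbhd U E x)" by blast
    then interpret connected_chair_free_graph U E x using U(2) by unfold_locales
    show ?thesis by (rule layout_width_le_connected)
  next
    case False
    then have "layout_width_le U E 8"
      by (intro layout_width_le_degree_le_2 U.finite_V symp_E) force
    then show ?thesis by (rule layout_width_le_mono) simp
  qed
qed

section \<open>Vertices of high degree\<close>

definition p1_chair_free :: "'a set \<Rightarrow> ('a \<Rightarrow> 'a \<Rightarrow> bool) \<Rightarrow> bool" where
  "p1_chair_free V E \<longleftrightarrow> (\<forall>z x a b c d. {z, x, a, b, c, d} \<subseteq> V \<and> chair E x a b c d \<longrightarrow>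
    E z x \<or> E z a \<or> E z b \<or> E z c \<or> E z d)"

lemma p1_chair_freeD:
  assumes "p1_chair_free V E" "{z, x, a, b, c, d} \<subseteq> V" "chair E x a b c d"
  shows "E z x \<or> E z a \<or> E z b \<or> E z c \<or> E z d"
  using assms by (simp add: p1_chair_free_def)

lemma p1_chair_free_subset: "p1_chair_free V E \<Longrightarrow> U \<subseteq> V \<Longrightarrow> p1_chair_free U E"
  unfolding p1_chair_free_def by (meson subset_trans)

text \<open>The argument for the Ramsey number \<open>R(3, 3) \<le> 6\<close>, applied to vertices with pairwise distinct
  values of \<open>f\<close>.\<close>

lemma triangle_free_card_image_le_5:
  assumes "finite S" "triangle_free S E"
    and indep: "\<And>p q r. p \<in> S \<Longrightarrow> q \<in> S \<Longrightarrow> r \<in> S \<Longrightarrow> \<not> E p q \<Longrightarrow> \<not> E p r \<Longrightarrow> \<not> E q r \<Longrightarrow>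
      f p = f q \<or> f p = f r \<or> f q = f r"
  shows "card (f ` S) \<le> 5"
proof (cases "S = {}")
  case False
  then obtain d where d: "d \<in> S" by blast
  have no_triangle: "\<not> (E p q \<and> E q r \<and> E p r)" if "p \<in> S" "q \<in> S" "r \<in> S" for p q r
    using assms(2) that unfolding triangle_free_def by blast
  let ?N = "{e \<in> S. E d e}" and ?M = "{e \<in> S. \<not> E d e \<and> f e \<noteq> f d}"
  have "card (f ` ?N) \<le> 2"
  proof (rule card_le_2_if_no_three)
    fix i j k assume "i \<in> f ` ?N" "j \<in> f ` ?N" "k \<in> f ` ?N"
    then obtain p q r where p: "p \<in> S" "q \<in> S" "r \<in> S" "E d p" "E d q" "E d r"
      and f: "i = f p" "j = f q" "k = f r" by blast
    have "\<not> E p q" "\<not> E p r" "\<not> E q r"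
      using no_triangle[of d p q] no_triangle[of d p r] no_triangle[of d q r] d p by blast+
    then show "i = j \<or> i = k \<or> j = k" using indep p f by blast
  qed (use assms(1) in simp)
  moreover have "card (f ` ?M) \<le> 2"
  proof (rule card_le_2_if_no_three)
    fix i j k assume "i \<in> f ` ?M" "j \<in> f ` ?M" "k \<in> f ` ?M"
    then obtain p q r where p: "p \<in> S" "q \<in> S" "r \<in> S" "\<not> E d p" "\<not> E d q" "\<not> E d r"
      "f p \<noteq> f d" "f q \<noteq> f d" "f r \<noteq> f d" and f: "i = f p" "j = f q" "k = f r" by blast
    have "E p q \<or> f p = f q" "E p r \<or> f p = f r" "E q r \<or> f q = f r"
      using indep[of d p q] indep[of d p r] indep[of d q r] d p by metis+
    then show "i = j \<or> i = k \<or> j = k" using no_triangle[of p q r] p f by blast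
  qed (use assms(1) in simp)
  moreover have "f ` S \<subseteq> {f d} \<union> f ` ?N \<union> f ` ?M" using d by blast
  then have "card (f ` S) \<le> card ({f d} \<union> f ` ?N \<union> f ` ?M)"
    using assms(1) by (intro card_mono) auto
  moreover have "card ({f d} \<union> f ` ?N \<union> f ` ?M) \<le> card {f d} + card (f ` ?N) + card (f ` ?M)"
    by (meson add_le_mono1 card_Un_le le_trans)
  ultimately show ?thesis by simp
qed simp

locale p1_chair_free_graph = triangle_free_graph +
  assumes p1_chair_free: "p1_chair_free V E"
begin

lemma chair_dominates:
  assumes "z \<in> V" "x \<in> V" "a \<in> V" "b \<in> V" "c \<in> V" "d \<in> V"
    and "E x a" "E x b" "E x c" "E c d" "\<not> E a d" "\<not> E b d" "a \<noteq> b"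
  shows "E z x \<or> E z a \<or> E z b \<or> E z c \<or> E z d"
proof -
  have "chair E x a b c d" using assms(2-) by (rule chairI)
  with p1_chair_free show ?thesis using assms(1-6) by (intro p1_chair_freeD) auto
qed

end

locale max_degree_vertex = p1_chair_free_graph +
  fixes v
  assumes v_in_V: "v \<in> V" and degree_v: "7 \<le> card (nbhd V E v)"
    and degree_le: "u \<in> V \<Longrightarrow> card (nbhd V E u) \<le> card (nbhd V E v)"
begin

definition A where "A = nbhd V E v"
definition B where "B = V - A - {v}"
definition seen where "seen d = nbhd A E d"
definition missed where "missed d = A - seen d"

definition rich where "rich = {d \<in> B. 2 * card (missed d) < card A}"
definition poor where "poor = B - rich"
definition blind where "blind = {d \<in> B. seen d = {}}"

lemma finite_A [simp]: "finite A"
  using finite_V by (simp add: A_def)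

lemma finite_B [simp]: "finite B"
  using finite_V by (simp add: B_def)

lemma finite_missed [simp]: "finite (missed d)"
  by (simp add: missed_def)

lemma finite_rich [simp]: "finite rich"
  by (simp add: rich_def)

lemma finite_poor [simp]: "finite poor"
  by (simp add: poor_def)

lemma mem_seen_iff: "a \<in> seen d \<longleftrightarrow> a \<in> A \<and> E d a"
  by (simp add: seen_def)

lemma mem_missed_iff: "a \<in> missed d \<longleftrightarrow> a \<in> A \<and> \<not> E d a"
  by (auto simp: missed_def mem_seen_iff)

lemma missed_eq_iff: "missed d = missed e \<longleftrightarrow> seen d = seen e"
  by (auto simp: set_eq_iff mem_missed_iff mem_seen_iff)

lemma mem_AD: "a \<in> A \<Longrightarrow> a \<in> V \<and> E v a \<and> E a v"
  using adj_commute by (auto simp: A_def)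

lemma mem_BD: "d \<in> B \<Longrightarrow> d \<in> V \<and> d \<noteq> v \<and> d \<notin> A \<and> \<not> E v d \<and> \<not> E d v"
  using adj_commute by (auto simp: A_def B_def)

lemma rich_in_B: "h \<in> rich \<Longrightarrow> h \<in> B"
  by (simp add: rich_def)

lemma blind_in_B: "t \<in> blind \<Longrightarrow> t \<in> B"
  by (simp add: blind_def)

lemma blind_nonadj_A: "t \<in> blind \<Longrightarrow> a \<in> A \<Longrightarrow> \<not> E t a \<and> \<not> E a t"
  using mem_seen_iff[of a t] adj_commute by (auto simp: blind_def)

lemma card_A_ge_7: "7 \<le> card A"
  using degree_v by (simp add: A_def)

lemma A_indep: "a \<in> A \<Longrightarrow> b \<in> A \<Longrightarrow> \<not> E a b"
  using not_adj_if_common_nbr[of v a b] mem_AD v_in_V by blast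

lemma chair_free_B: "chair_free B E"
  unfolding chair_free_def
proof (intro allI impI notI)
  fix x a b c d assume xabcd: "{x, a, b, c, d} \<subseteq> B" and chair: "chair E x a b c d"
  have "{v, x, a, b, c, d} \<subseteq> V" using xabcd mem_BD v_in_V by blast
  with p1_chair_free have "E v x \<or> E v a \<or> E v b \<or> E v c \<or> E v d"
    using chair by (rule p1_chair_freeD)
  then show False using xabcd mem_BD by blast
qed

lemma card_nbhd_B_le_card_missed:
  assumes "d \<in> B"
  shows "card (nbhd B E d) \<le> card (missed d)"
proof -
  have "nbhd V E d = seen d \<union> nbhd B E d"
    using mem_BD[OF assms] by (auto simp: seen_def A_def B_def)
  moreover have "seen d \<inter> nbhd B E d = {}" by (auto simp: seen_def B_def)
  ultimately have "card (nbhd V E d) = card (seen d) + card (nbhd B E d)"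
    by (simp add: card_Un_disjoint seen_def)
  moreover have "card (nbhd V E d) \<le> card A"
    using degree_le[of d] mem_BD[OF assms] by (simp add: A_def)
  moreover have "card (missed d) = card A - card (seen d)" "card (seen d) \<le> card A"
    by (auto simp: missed_def seen_def nbhd_subset card_Diff_subset intro!: card_mono)
  ultimately show ?thesis by linarith
qed

subsection \<open>Vertices that miss few neighbours of \<open>v\<close>\<close>

lemma seen_subset_if_two_missed:
  assumes "d \<in> B" "e \<in> B" "\<not> E d e" "a \<in> missed d \<inter> missed e" "b \<in> missed d \<inter> missed e" "a \<noteq> b"
  shows "seen d \<subseteq> seen e"
proof
  fix c assume "c \<in> seen d"
  then show "c \<in> seen e"
    using chair_dominates[of e v a b c d] assms v_in_V mem_AD mem_BD adj_commute
    unfolding mem_seen_iff Int_iff mem_missed_iff by blast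
qed

lemma missed_Int_unique:
  assumes "d \<in> B" "e \<in> B" "\<not> E d e" "seen d \<noteq> seen e"
    and "a \<in> missed d \<inter> missed e" "b \<in> missed d \<inter> missed e"
  shows "a = b"
proof (rule ccontr)
  assume "a \<noteq> b"
  have "seen d \<subseteq> seen e"
    using assms(1-3,5,6) \<open>a \<noteq> b\<close> by (rule seen_subset_if_two_missed)
  moreover have "seen e \<subseteq> seen d"
    using assms adj_commute \<open>a \<noteq> b\<close> by (intro seen_subset_if_two_missed[of e d a b]) auto
  ultimately show False using assms(4) by blast
qed

lemma card_missed_Int_le_1:
  assumes "d \<in> B" "e \<in> B" "\<not> E d e" "seen d \<noteq> seen e"
  shows "card (missed d \<inter> missed e) \<le> 1"
  using missed_Int_unique[OF assms] by (intro card_le_1_if_unique) simp_all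

lemma rich_ex_common_seen:
  assumes "h \<in> rich" "e \<in> rich"
  obtains a where "a \<in> A" "E h a" "E e a"
proof -
  have "card (missed h \<union> missed e) \<le> card (missed h) + card (missed e)" by (rule card_Un_le)
  also have "\<dots> < card A" using assms by (simp add: rich_def)
  finally have "missed h \<union> missed e \<noteq> A" by auto
  then show ?thesis using that by (auto simp: mem_missed_iff)
qed

lemma rich_indep:
  assumes "h \<in> rich" "e \<in> rich"
  shows "\<not> E h e"
proof -
  obtain a where "a \<in> A" "E h a" "E e a" using assms by (rule rich_ex_common_seen)
  then show ?thesis
    using not_adj_if_common_nbr[of a h e] assms mem_AD mem_BD rich_in_B adj_commute by blast
qed

lemma rich_missed_Int_unique:
  assumes "h \<in> rich" "e \<in> rich" "seen h \<noteq> seen e"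
    and "a \<in> missed h \<inter> missed e" "b \<in> missed h \<inter> missed e"
  shows "a = b"
  using assms rich_in_B rich_indep missed_Int_unique[of h e a b] by blast

lemma rich_card_missed_Diff_le_1:
  assumes "h \<in> rich" "e \<in> rich" "a \<in> missed h \<inter> missed e"
  shows "card (missed e - missed h) \<le> 1"
proof (rule card_le_1_if_unique)
  fix b b' assume b: "b \<in> missed e - missed h" "b' \<in> missed e - missed h"
  obtain c where c: "c \<in> A" "E h c" "E e c" using assms(1,2) by (rule rich_ex_common_seen)
  have a: "a \<in> A" "\<not> E a h" "\<not> E a e"
    using assms(3) adj_commute by (auto simp: mem_missed_iff)
  have b': "b \<in> A" "b' \<in> A" "E h b" "E h b'" "\<not> E b e" "\<not> E b' e"
    using b adj_commute by (auto simp: mem_missed_iff)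
  have "\<not> E a b" "\<not> E a b'" "\<not> E a c" using a b' c A_indep by blast+
  moreover have "E c e" using c adj_commute by blast
  moreover have "a \<in> V" "h \<in> V" "b \<in> V" "b' \<in> V" "c \<in> V" "e \<in> V"
    using a b' c assms(1,2) mem_AD mem_BD rich_in_B by blast+
  ultimately show "b = b'"
    using chair_dominates[of a h b b' c e] a b' c by blast
qed simp

lemma rich_card_missed_le_2:
  assumes "h \<in> rich" "e \<in> rich" "seen h \<noteq> seen e" "a \<in> missed h \<inter> missed e"
  shows "card (missed e) \<le> 2"
proof -
  have "card (missed e) = card (missed e \<inter> missed h) + card (missed e - missed h)"
    by (rule card_Int_Diff) simp
  moreover have "card (missed e \<inter> missed h) \<le> 1"
    using assms rich_in_B rich_indep by (intro card_missed_Int_le_1) auto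
  moreover have "card (missed e - missed h) \<le> 1"
    using assms(1,2,4) by (rule rich_card_missed_Diff_le_1)
  ultimately show ?thesis by linarith
qed

lemma rich_unique_if_missed_and_seen:
  assumes "f \<in> rich" "a \<in> missed f" "b \<in> missed f" and "d \<in> rich" "b \<in> missed d" "a \<in> seen d"
    and "e \<in> rich" "b \<in> missed e" "a \<in> seen e"
  shows "d = e"
proof (rule ccontr)
  assume "d \<noteq> e"
  have "f \<in> V" "d \<in> V" "e \<in> V" and "\<not> E f d" "\<not> E f e" "\<not> E f v"
    using assms(1,4,7) rich_in_B mem_BD rich_indep by blast+
  then show False
    using chair_dominates[of f a d e v b] \<open>d \<noteq> e\<close> assms v_in_V mem_AD adj_commute
    unfolding mem_missed_iff mem_seen_iff by blast
qed

lemma rich_unique_if_common_missed: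
  assumes p: "p \<in> rich" "b \<in> missed p" "missed p \<noteq> {b}"
    and q: "q \<in> rich" "b \<in> missed q" "seen p \<noteq> seen q"
    and r: "r \<in> rich" "b \<in> missed r" "seen p \<noteq> seen r"
  shows "q = r"
proof -
  obtain a where a: "a \<in> missed p" "a \<noteq> b" using p(2,3) by blast
  have "a \<in> seen d" if "d \<in> rich" "b \<in> missed d" "seen p \<noteq> seen d" for d
    using rich_missed_Int_unique[of p d a b] that p a by (auto simp: missed_def)
  then show ?thesis using rich_unique_if_missed_and_seen[of p a b q r] a p q r by blast
qed

lemma card_seen_of_rich_missing_le_2:
  assumes "b \<in> A"
  shows "card (seen ` {h \<in> rich. b \<in> missed h}) \<le> 2"
proof (rule card_le_2_if_no_three)
  fix S1 S2 S3
  assume "S1 \<in> seen ` {h \<in> rich. b \<in> missed h}" "S2 \<in> seen ` {h \<in> rich. b \<in> missed h}"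
    "S3 \<in> seen ` {h \<in> rich. b \<in> missed h}"
  then obtain h1 h2 h3 where h: "h1 \<in> rich" "h2 \<in> rich" "h3 \<in> rich"
      "b \<in> missed h1" "b \<in> missed h2" "b \<in> missed h3"
    and S: "S1 = seen h1" "S2 = seen h2" "S3 = seen h3" by blast
  show "S1 = S2 \<or> S1 = S3 \<or> S2 = S3"
  proof (cases "missed h1 = {b}")
    case True
    then have "seen h1 = seen h2 \<or> missed h2 \<noteq> {b}" using missed_eq_iff by metis
    then show ?thesis
      using S h rich_unique_if_common_missed[of h2 b h1 h3] by metis
  next
    case False
    then show ?thesis
      using S h rich_unique_if_common_missed[of h1 b h2 h3] by metis
  qed
qed simp

subsection \<open>Vertices that miss many neighbours of \<open>v\<close>\<close>

lemma poor_indep_seen_eq: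
  assumes "p \<in> poor" "q \<in> poor" "r \<in> poor" and nadj: "\<not> E p q" "\<not> E p r" "\<not> E q r"
  shows "seen p = seen q \<or> seen p = seen r \<or> seen q = seen r"
proof (rule ccontr)
  assume ne: "\<not> ?thesis"
  have B: "p \<in> B" "q \<in> B" "r \<in> B" using assms(1-3) by (simp_all add: poor_def)
  have "card (missed p \<inter> missed q) \<le> 1" "card (missed p \<inter> missed r) \<le> 1"
    "card (missed q \<inter> missed r) \<le> 1"
    using card_missed_Int_le_1[of p q] card_missed_Int_le_1[of p r] card_missed_Int_le_1[of q r]
      B nadj ne by blast+
  moreover have "card (missed p) + card (missed q) =
      card (missed p \<union> missed q) + card (missed p \<inter> missed q)"
    by (rule card_Un_Int) auto
  moreover have "card (missed p \<union> missed q) + card (missed r) =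
      card (missed p \<union> missed q \<union> missed r) + card ((missed p \<union> missed q) \<inter> missed r)"
    by (rule card_Un_Int) auto
  moreover have "card ((missed p \<union> missed q) \<inter> missed r) \<le>
      card (missed p \<inter> missed r) + card (missed q \<inter> missed r)"
    unfolding Int_Un_distrib2 by (rule card_Un_le)
  moreover have "card (missed p \<union> missed q \<union> missed r) \<le> card A"
    by (intro card_mono) (auto simp: missed_def)
  ultimately have "card (missed p) + card (missed q) + card (missed r) \<le> card A + 3" by linarith
  moreover have "card A \<le> 2 * card (missed d)" if "d \<in> poor" for d
    using that by (auto simp: poor_def rich_def)
  note this[OF assms(1)] this[OF assms(2)] this[OF assms(3)]
  ultimately show False using card_A_ge_7 by linarith
qed

lemma card_seen_poor_le_5: "card (seen ` poor) \<le> 5"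
proof (rule triangle_free_card_image_le_5)
  have "poor \<subseteq> V" using mem_BD by (auto simp: poor_def)
  with triangle_free show "triangle_free poor E" by (rule triangle_free_subset)
qed (simp, rule poor_indep_seen_eq)

subsection \<open>Vertices that miss every neighbour of \<open>v\<close>\<close>

lemma card_missed_le_1_if_blind_nonadj:
  assumes "t \<in> blind" "h \<in> rich" "\<not> E t h"
  shows "card (missed h) \<le> 1"
proof -
  have "seen t = {}" using assms(1) by (simp add: blind_def)
  moreover have "seen h \<noteq> {}"
    using assms(2) rich_ex_common_seen[of h h] mem_seen_iff[of _ h] by blast
  ultimately have "card (missed t \<inter> missed h) \<le> 1"
    using assms blind_in_B rich_in_B by (intro card_missed_Int_le_1) auto
  moreover have "missed t \<inter> missed h = missed h"
    using \<open>seen t = {}\<close> by (auto simp: missed_def)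
  ultimately show ?thesis by simp
qed

lemma blind_nonadj_missed_disjoint:
  assumes "t \<in> blind" "h \<in> rich" "e \<in> rich" "\<not> E t h" "\<not> E t e" "x \<in> missed h \<inter> missed e"
  shows "h = e"
proof (rule ccontr)
  assume "h \<noteq> e"
  obtain a where a: "a \<in> A" "E h a" "E e a" using assms(2,3) by (rule rich_ex_common_seen)
  then have adj: "E a h" "E a e" using adj_commute by blast+
  have x: "x \<in> A" "\<not> E h x" "\<not> E e x" using assms(6) by (auto simp: mem_missed_iff)
  have "\<not> E t a" "\<not> E t x" "\<not> E t v" using assms(1) a x blind_nonadj_A mem_BD blind_in_B by blast+
  moreover have "t \<in> V" "h \<in> V" "e \<in> V" "a \<in> V" "x \<in> V"
    using assms(1-3) a x mem_AD mem_BD rich_in_B blind_in_B by blast+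
  ultimately show False
    using chair_dominates[of t a h e v x] \<open>h \<noteq> e\<close> v_in_V mem_AD adj a x assms(4,5) by blast
qed

lemma blind_nbr_misses_if_nonnbrs_differ:
  assumes "t \<in> blind" "h \<in> rich" "e \<in> rich" "\<not> E t h" "\<not> E t e" "x \<in> missed h" "x \<in> seen e"
    and "g \<in> rich" "E t g"
  shows "x \<in> missed g"
proof (rule ccontr)
  assume "x \<notin> missed g"
  then have x: "x \<in> A" "\<not> E h x" "E x e" "E x g"
    using assms(6,7) adj_commute by (auto simp: mem_missed_iff mem_seen_iff)
  have "\<not> E e t" "\<not> E h t" "E g t" using assms(4,5,9) adj_commute by blast+
  moreover have "\<not> E h e" "\<not> E h g" "\<not> E v t" "\<not> E h v" "v \<noteq> e"
    using assms(1-3,8) rich_indep mem_BD rich_in_B blind_in_B by blast+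
  moreover have "t \<in> V" "h \<in> V" "e \<in> V" "g \<in> V" "x \<in> V"
    using assms(1-3,8) x mem_AD mem_BD rich_in_B blind_in_B by blast+
  ultimately show False
    using chair_dominates[of h x v e g t] v_in_V x mem_AD by blast
qed

lemma blind_nonadj_unique:
  assumes t: "t \<in> blind" "g \<in> rich" "E t g" "card (missed g) \<le> 1"
    and h: "h \<in> rich" "\<not> E t h" "missed h \<noteq> {}" and e: "e \<in> rich" "\<not> E t e" "missed e \<noteq> {}"
  shows "h = e"
proof (rule ccontr)
  assume "h \<noteq> e"
  obtain x y where xy: "x \<in> missed h" "y \<in> missed e" using h(3) e(3) by blast
  then have "x \<in> seen e" and "y \<in> seen h"
    using blind_nonadj_missed_disjoint[of t h e] \<open>h \<noteq> e\<close> t(1) h(1,2) e(1,2)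
    by (auto simp: missed_def)
  moreover from this have "x \<in> missed g" "y \<in> missed g"
    using blind_nbr_misses_if_nonnbrs_differ[OF t(1) h(1) e(1) h(2) e(2) xy(1) _ t(2,3)]
      blind_nbr_misses_if_nonnbrs_differ[OF t(1) e(1) h(1) e(2) h(2) xy(2) _ t(2,3)] by blast+
  moreover have "x \<noteq> y" using xy(2) \<open>x \<in> seen e\<close> by (auto simp: missed_def)
  ultimately show False using t(4) card_le_Suc0_iff_eq[of "missed g"] by auto
qed

definition linked where
  "linked = {t \<in> blind. \<exists>h\<in>rich. card (missed h) \<le> 1 \<and> E t h}"

lemma blind_nbr_unique:
  assumes "h \<in> rich" "card (missed h) \<le> 1" "t \<in> blind" "E t h" "s \<in> blind" "E s h"
  shows "s = t"
proof -
  have "card (nbhd B E h) \<le> 1"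
    using card_nbhd_B_le_card_missed[of h] assms(1,2) rich_in_B by fastforce
  moreover have "s \<in> nbhd B E h" "t \<in> nbhd B E h" using assms blind_in_B adj_commute by auto
  ultimately show ?thesis using card_le_Suc0_iff_eq[of "nbhd B E h"] by auto
qed

lemma card_linked_le_2: "card linked \<le> 2"
proof (rule card_le_2_if_no_three)
  fix r s t assume "r \<in> linked" "s \<in> linked" "t \<in> linked"
  then obtain f g h where blind: "r \<in> blind" "s \<in> blind" "t \<in> blind"
    and rich: "f \<in> rich" "g \<in> rich" "h \<in> rich"
    and card: "card (missed f) \<le> 1" "card (missed g) \<le> 1" "card (missed h) \<le> 1"
    and adj: "E r f" "E s g" "E t h" unfolding linked_def by blast
  have "missed e \<noteq> {}" if "e \<in> rich" "u \<in> blind" "E u e" for e u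
  proof
    assume "missed e = {}"
    then have "nbhd B E e = {}" using card_nbhd_B_le_card_missed[of e] that(1) rich_in_B by simp
    then show False using that blind_in_B adj_commute by (auto simp: nbhd_def)
  qed
  then have "missed g \<noteq> {}" "missed h \<noteq> {}" using blind rich adj by blast+
  then have "E r g \<or> E r h \<or> g = h"
    using blind_nonadj_unique[OF blind(1) rich(1) adj(1) card(1)] rich by blast
  then show "r = s \<or> r = t \<or> s = t"
    using blind_nbr_unique[OF rich(2) card(2)] blind_nbr_unique[OF rich(3) card(3)] blind adj
    by blast
qed (simp add: linked_def blind_def)

lemma blind_adj_rich_iff:
  assumes "t \<in> blind - linked" "h \<in> rich"
  shows "E t h \<longleftrightarrow> 2 \<le> card (missed h)"
  using assms card_missed_le_1_if_blind_nonadj[of t h] by (force simp: linked_def)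

subsection \<open>Reduction to a chair-free graph and to paths and cycles\<close>

text \<open>The neighbourhoods in \<open>A\<close> that are treated as vertex classes of their own.\<close>

definition exceptional where
  "exceptional = {{}} \<union> seen ` poor \<union> seen ` {h \<in> rich. \<exists>d\<in>poor - blind. E h d}"

definition ordinary where "ordinary = {h \<in> B. seen h \<notin> exceptional}"
definition core where "core = B - ordinary - linked"

lemma finite_exceptional: "finite exceptional"
  by (simp add: exceptional_def)

lemma card_exceptional_le_16: "card exceptional \<le> 16"
proof -
  let ?R = "{h \<in> rich. \<exists>d\<in>poor - blind. E h d}" and ?S = "seen ` poor - {{}}"
  let ?F = "\<lambda>S. seen ` {h \<in> rich. S \<subseteq> missed h}"
  have "seen h \<in> (\<Union>S\<in>?S. ?F S)" if h: "h \<in> rich" and d: "d \<in> poor - blind" "E h d" for h d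
  proof -
    have "d \<in> B" using d by (simp add: poor_def)
    have "a \<in> missed h" if "a \<in> seen d" for a
      using that not_adj_if_common_nbr[of d h a] mem_AD mem_BD[OF \<open>d \<in> B\<close>]
        mem_BD[OF rich_in_B[OF h]] d(2) adj_commute
      unfolding mem_seen_iff mem_missed_iff by blast
    moreover have "seen d \<in> ?S" using d(1) \<open>d \<in> B\<close> by (auto simp: blind_def)
    ultimately show ?thesis using h by blast
  qed
  then have "card (seen ` ?R) \<le> card (\<Union>S\<in>?S. ?F S)" by (intro card_mono) auto
  also have "\<dots> \<le> (\<Sum>S\<in>?S. card (?F S))" by (intro card_UN_le) simp
  also have "\<dots> \<le> (\<Sum>S\<in>?S. 2)"
  proof (rule sum_mono)
    fix S assume "S \<in> ?S"
    then obtain b where b: "b \<in> S" "b \<in> A" by (auto simp: seen_def)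
    have "card (?F S) \<le> card (seen ` {h \<in> rich. b \<in> missed h})" using b by (intro card_mono) auto
    also have "\<dots> \<le> 2" using b(2) by (rule card_seen_of_rich_missing_le_2)
    finally show "card (?F S) \<le> 2" .
  qed
  also have "\<dots> \<le> 10" using card_Diff1_le[of "seen ` poor" "{}"] card_seen_poor_le_5 by simp
  finally have "card (seen ` ?R) \<le> 10" .
  moreover have "card exceptional \<le> card {{} :: 'a set} + card (seen ` poor) + card (seen ` ?R)"
    unfolding exceptional_def by (meson add_le_mono1 card_Un_le le_trans)
  ultimately show ?thesis using card_seen_poor_le_5 by simp
qed

lemma ordinary_in_rich: "h \<in> ordinary \<Longrightarrow> h \<in> rich"
  by (auto simp: ordinary_def exceptional_def poor_def)

lemma ordinary_indep: "h \<in> ordinary \<Longrightarrow> e \<in> ordinary \<Longrightarrow> \<not> E h e"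
  using ordinary_in_rich rich_indep by blast

lemma core_in_B: "d \<in> core \<Longrightarrow> d \<in> B"
  by (simp add: core_def)

lemma seen_core_exceptional: "d \<in> core \<Longrightarrow> seen d \<in> exceptional"
  by (simp add: core_def ordinary_def)

lemma ordinary_core_nonadj:
  assumes "h \<in> ordinary" "d \<in> core - blind"
  shows "\<not> E h d"
proof (cases "d \<in> rich")
  case True
  then show ?thesis using assms(1) ordinary_in_rich rich_indep by blast
next
  case False
  then have "d \<in> poor - blind" using assms(2) by (simp add: core_def poor_def)
  then show ?thesis
    using assms(1) ordinary_in_rich[OF assms(1)] by (auto simp: ordinary_def exceptional_def)
qed

lemma V_minus_linked: "V - insert v linked = A \<union> ordinary \<union> core"
proof -
  have "linked \<inter> ordinary = {}" "linked \<subseteq> B" "ordinary \<subseteq> B"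
    by (auto simp: linked_def blind_def ordinary_def exceptional_def)
  moreover have "v \<notin> A" using mem_AD not_adj_self by blast
  then have "V - {v} = A \<union> B" "A \<inter> B = {}" using mem_AD by (auto simp: B_def)
  ultimately show ?thesis unfolding core_def by blast
qed

lemma parts_disjoint: "A \<inter> ordinary = {}" "A \<inter> core = {}" "ordinary \<inter> core = {}"
  by (auto simp: core_def ordinary_def B_def)

definition flipped where
  "flipped u w \<longleftrightarrow> u \<in> core \<and> w \<in> core \<and> E u w \<or>
    \<not> E u w \<and> (u \<in> A \<and> w \<in> ordinary \<or> u \<in> ordinary \<and> w \<in> A)"

lemma symp_flipped: "symp flipped"
  using adj_commute by (auto simp: flipped_def symp_def)

lemma flipped_ordinary_iff: "h \<in> ordinary \<Longrightarrow> flipped h w \<longleftrightarrow> w \<in> missed h"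
  using parts_disjoint by (auto simp: flipped_def mem_missed_iff)

lemma flipped_A_iff: "a \<in> A \<Longrightarrow> flipped a w \<longleftrightarrow> w \<in> ordinary \<and> a \<in> missed w"
  using parts_disjoint adj_commute by (auto simp: flipped_def mem_missed_iff)

lemma layout_width_le_core: "layout_width_le core flipped 20"
proof -
  have "core \<subseteq> V" "core \<subseteq> B" using core_in_B mem_BD by blast+
  then interpret core: chair_free_graph core E
    using chair_free_graph_subset chair_free_subset[OF chair_free_B] by blast
  show ?thesis
    using core.layout_width_le_chair_free
    by (rule layout_width_le_cong) (use parts_disjoint in \<open>auto simp: flipped_def\<close>)
qed

lemma inj_on_seen_if_irreducible:
  assumes "\<not> reducible U flipped"
  shows "inj_on seen (U \<inter> ordinary)"
proof (rule inj_onI, rule ccontr)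
  fix h e assume he: "h \<in> U \<inter> ordinary" "e \<in> U \<inter> ordinary" "seen h = seen e" "h \<noteq> e"
  have "missed h = missed e" using he(3) missed_eq_iff by blast
  then have "twins U flipped h e" using he flipped_ordinary_iff by (simp add: twins_def)
  then show False using assms by (auto simp: reducible_def attachable_def)
qed

lemma degree_A_le_2_if_irreducible:
  assumes "finite U" "\<not> reducible U flipped" "a \<in> A"
  shows "card (nbhd U flipped a) \<le> 2"
proof -
  let ?S = "{h \<in> U \<inter> ordinary. a \<in> missed h}"
  have "nbhd U flipped a = ?S" unfolding nbhd_def flipped_A_iff[OF assms(3)] by blast
  moreover have "inj_on seen ?S"
    using inj_on_seen_if_irreducible[OF assms(2)] by (rule inj_on_subset) auto
  then have "card ?S = card (seen ` ?S)" by (simp add: card_image)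
  moreover have "card (seen ` ?S) \<le> card (seen ` {h \<in> rich. a \<in> missed h})"
    using ordinary_in_rich by (intro card_mono) auto
  ultimately show ?thesis using card_seen_of_rich_missing_le_2[OF assms(3)] by simp
qed

lemma degree_ordinary_le_2_if_irreducible:
  assumes "finite U" "\<not> reducible U flipped" "h \<in> U \<inter> ordinary"
  shows "card (nbhd U flipped h) \<le> 2"
proof (cases "nbhd U flipped h = {}")
  case False
  then obtain a where a: "a \<in> U" "a \<in> missed h" using flipped_ordinary_iff assms(3) by auto
  then have "a \<in> A" by (simp add: mem_missed_iff)
  have "U \<noteq> {a}" using assms(3) \<open>a \<in> A\<close> parts_disjoint by blast
  then have "\<not> card (nbhd U flipped a) \<le> 1"
    using reducible_if_degree_le_1[of U a flipped] a(1) assms(1,2) by blast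
  then have "\<not> nbhd U flipped a \<subseteq> {h}" using card_mono[of "{h}" "nbhd U flipped a"] by auto
  then obtain e where "e \<in> nbhd U flipped a" and "e \<noteq> h" by blast
  then have e: "e \<in> U \<inter> ordinary" "a \<in> missed e" "e \<noteq> h"
    using flipped_A_iff[OF \<open>a \<in> A\<close>] by auto
  then have "seen e \<noteq> seen h"
    using inj_onD[OF inj_on_seen_if_irreducible[OF assms(2)]] assms(3) by blast
  then have "card (missed h) \<le> 2"
    using rich_card_missed_le_2[of e h a] e a(2) assms(3) ordinary_in_rich by blast
  moreover have "card (nbhd U flipped h) \<le> card (missed h)"
    using flipped_ordinary_iff assms(3) by (intro card_mono) auto
  ultimately show ?thesis by linarith
qed simp

lemma layout_width_le_A_ordinary: "layout_width_le (A \<union> ordinary) flipped 8"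
proof (rule layout_width_le_reducible[OF _ symp_flipped])
  show fin: "finite (A \<union> ordinary)" by (simp add: ordinary_def)
  fix U assume U: "U \<subseteq> A \<union> ordinary" "\<not> reducible U flipped"
  have "finite U" using U(1) fin by (rule finite_subset)
  moreover from this have "card (nbhd U flipped u) \<le> 2" if "u \<in> U" for u
    using degree_A_le_2_if_irreducible degree_ordinary_le_2_if_irreducible U that by blast
  ultimately show "layout_width_le U flipped 8"
    using symp_flipped by (intro layout_width_le_degree_le_2)
qed simp

lemma layout_width_le_flipped: "layout_width_le (A \<union> ordinary \<union> core) flipped 20"
proof (rule layout_width_le_disjoint_union)
  show "layout_width_le (A \<union> ordinary) flipped 20"
    using layout_width_le_A_ordinary by (rule layout_width_le_mono) simp
  show "layout_width_le core flipped 20" by (rule layout_width_le_core)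
qed (use parts_disjoint in \<open>auto simp: flipped_def\<close>)

definition flip where
  "flip u w \<longleftrightarrow> u \<in> A \<and> (w \<in> ordinary \<or> w \<in> core \<and> u \<in> seen w) \<or>
    w \<in> A \<and> (u \<in> ordinary \<or> u \<in> core \<and> w \<in> seen u) \<or>
    u \<in> ordinary \<and> 2 \<le> card (missed u) \<and> w \<in> blind \<or>
    u \<in> blind \<and> w \<in> ordinary \<and> 2 \<le> card (missed w)"

lemma adj_iff_flipped:
  assumes "u \<in> A \<union> ordinary \<union> core" "w \<in> A \<union> ordinary \<union> core"
  shows "E u w \<longleftrightarrow> (flipped u w \<noteq> flip u w)"
proof -
  have blind: "t \<notin> A" "t \<notin> ordinary" if "t \<in> blind" for t
    using that mem_BD[OF blind_in_B] by (simp_all add: ordinary_def exceptional_def blind_def)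
  have A_core: "E a d \<longleftrightarrow> a \<in> seen d" "E d a \<longleftrightarrow> a \<in> seen d" if "a \<in> A" for a d
    using that adj_commute[of a d] by (simp_all add: mem_seen_iff)
  have ordinary_core: "E h d \<longleftrightarrow> d \<in> blind \<and> 2 \<le> card (missed h)"
    "E d h \<longleftrightarrow> d \<in> blind \<and> 2 \<le> card (missed h)" if "h \<in> ordinary" "d \<in> core" for h d
    using that ordinary_core_nonadj[of h d] blind_adj_rich_iff[of d h] ordinary_in_rich[of h]
      adj_commute[of h d] by (auto simp: core_def)
  have parts: "t \<in> A \<longrightarrow> t \<notin> ordinary \<and> t \<notin> core \<and> t \<notin> blind"
    "t \<in> ordinary \<longrightarrow> t \<notin> A \<and> t \<notin> core \<and> t \<notin> blind" "t \<in> core \<longrightarrow> t \<notin> A \<and> t \<notin> ordinary" for t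
    using parts_disjoint blind by blast+
  have u: "u \<in> A \<or> u \<in> ordinary \<or> u \<in> core" using assms(1) by blast
  consider (A) "w \<in> A" | (ordinary) "w \<in> ordinary" | (core) "w \<in> core" using assms(2) by blast
  then show ?thesis
  proof cases
    case A
    then show ?thesis
      using u parts[of u] parts[of w] A_indep[of u w] A_core(2)[of w u]
      unfolding flipped_def flip_def by blast
  next
    case ordinary
    then show ?thesis
      using u parts[of u] parts[of w] ordinary_indep[of u w] ordinary_core(2)[of w u]
      unfolding flipped_def flip_def by blast
  next
    case core
    then show ?thesis
      using u parts[of u] parts[of w] A_core(1)[of u w] ordinary_core(1)[of u w]
      unfolding flipped_def flip_def by blast
  qed
qed

definition flip_class where
  "flip_class u = (u \<in> A, u \<in> ordinary, u \<in> blind, 2 \<le> card (missed u),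
    {S \<in> exceptional. u \<in> S}, if u \<in> core then seen u else {})"

lemma card_flip_class_le: "card (flip_class ` U) \<le> 2 ^ 4 * (2 ^ 16 * 16)"
proof -
  let ?B = "UNIV :: bool set"
  have "{} \<in> exceptional" by (simp add: exceptional_def)
  then have "(if u \<in> core then seen u else {}) \<in> exceptional" for u
    using seen_core_exceptional by simp
  then have "flip_class ` U \<subseteq> ?B \<times> ?B \<times> ?B \<times> ?B \<times> Pow exceptional \<times> exceptional"
    unfolding flip_class_def by blast
  then have "card (flip_class ` U) \<le>
      card (?B \<times> ?B \<times> ?B \<times> ?B \<times> Pow exceptional \<times> exceptional)"
    using finite_exceptional by (intro card_mono) simp_all
  also have "\<dots> = 2 ^ 4 * (2 ^ card exceptional * card exceptional)"
    using finite_exceptional by (simp add: card_cartesian_product card_Pow)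
  also have "\<dots> \<le> 2 ^ 4 * (2 ^ 16 * 16)"
    using card_exceptional_le_16 by (intro mult_le_mono power_increasing) auto
  finally show ?thesis .
qed

lemma flip_factors_through_class: "\<exists>R. \<forall>u w. flip u w \<longleftrightarrow> R (flip_class u) w"
proof -
  define R where "R = (\<lambda>(a, h, t, m, X, Y) w.
    a \<and> (w \<in> ordinary \<or> w \<in> core \<and> seen w \<in> X) \<or> w \<in> A \<and> (h \<or> w \<in> Y) \<or>
    h \<and> m \<and> w \<in> blind \<or> t \<and> w \<in> ordinary \<and> 2 \<le> card (missed w))"
  have "flip u w \<longleftrightarrow> R (flip_class u) w" for u w
    using seen_core_exceptional[of w] by (auto simp: flip_def R_def flip_class_def)
  then show ?thesis by blast
qed

lemma layout_width_le_max_degree: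
  "layout_width_le V E ((3 + 1) * 2 ^ 3 * (2 ^ 4 * (2 ^ 16 * 16) * (20 + 1) + 1))"
proof -
  obtain R where R: "\<forall>u w. flip u w \<longleftrightarrow> R (flip_class u) w"
    using flip_factors_through_class ..
  have "layout_width_le (A \<union> ordinary \<union> core) E (2 ^ 4 * (2 ^ 16 * 16) * (20 + 1))"
    using layout_width_le_flipped card_flip_class_le
    by (rule layout_width_le_flip) (simp only: adj_iff_flipped R)
  then have wd: "layout_width_le (V - insert v linked) E (2 ^ 4 * (2 ^ 16 * 16) * (20 + 1))"
    unfolding V_minus_linked .
  have "finite linked" by (simp add: linked_def blind_def)
  then have "finite (insert v linked)" "card (insert v linked) \<le> 3"
    using card_linked_le_2 by (simp_all add: card_insert_if)
  moreover have "insert v linked \<subseteq> V" using v_in_V mem_BD by (auto simp: linked_def blind_def)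
  ultimately show ?thesis by (intro layout_width_le_delete[OF _ _ _ wd])
qed

end

subsection \<open>Triangle-free graphs in which every chair dominates\<close>

lemma (in p1_chair_free_graph) card_V_le_if_chair:
  assumes chair: "chair E x a b c d" and V: "{x, a, b, c, d} \<subseteq> V"
    and degree: "\<And>u. u \<in> V \<Longrightarrow> card (nbhd V E u) \<le> k"
  shows "card V \<le> 5 * k"
proof -
  let ?S = "{x, a, b, c, d}"
  have "V \<subseteq> (\<Union>s\<in>?S. nbhd V E s)"
  proof
    fix z assume "z \<in> V"
    with V have "E z x \<or> E z a \<or> E z b \<or> E z c \<or> E z d"
      using chair by (intro p1_chair_freeD[OF p1_chair_free]) auto
    then show "z \<in> (\<Union>s\<in>?S. nbhd V E s)" using \<open>z \<in> V\<close> adj_commute by auto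
  qed
  then have "card V \<le> card (\<Union>s\<in>?S. nbhd V E s)" using finite_V by (intro card_mono) auto
  also have "\<dots> \<le> (\<Sum>s\<in>?S. card (nbhd V E s))" by (intro card_UN_le) simp
  also have "\<dots> \<le> (\<Sum>s\<in>?S. k)" using degree V by (intro sum_mono) blast
  also have "\<dots> = card ?S * k" by simp
  also have "\<dots> \<le> 5 * k" using card_length[of "[x, a, b, c, d]"] by (intro mult_le_mono1) simp
  finally show ?thesis .
qed

lemma (in p1_chair_free_graph) layout_width_le_degree_le_6:
  assumes degree: "\<And>u. u \<in> V \<Longrightarrow> card (nbhd V E u) \<le> 6"
  shows "layout_width_le V E 30"
proof (cases "chair_free V E")
  case True
  then interpret chair_free_graph V E by unfold_locales
  show ?thesis using layout_width_le_chair_free by (rule layout_width_le_mono) simp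
next
  case False
  then obtain x a b c d where "chair E x a b c d" "{x, a, b, c, d} \<subseteq> V"
    unfolding chair_free_def by blast
  then have "card V \<le> 5 * 6" using degree by (rule card_V_le_if_chair)
  then show ?thesis by (intro layout_width_le_mono[OF layout_width_le_card[OF finite_V]]) simp
qed

definition width_bound :: nat where
  "width_bound = (3 + 1) * 2 ^ 3 * (2 ^ 4 * (2 ^ 16 * 16) * (20 + 1) + 1)"

lemma (in p1_chair_free_graph) layout_width_le_triangle_free: "layout_width_le V E width_bound"
proof (cases "\<forall>u\<in>V. card (nbhd V E u) \<le> 6")
  case True
  then have "layout_width_le V E 30" by (intro layout_width_le_degree_le_6) blast
  then show ?thesis by (rule layout_width_le_mono) (simp add: width_bound_def)
next
  case False
  let ?deg = "\<lambda>u. card (nbhd V E u)"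
  have "V \<noteq> {}" using False by blast
  then have "Max (?deg ` V) \<in> ?deg ` V" using finite_V by (intro Max_in) auto
  then obtain v where v: "v \<in> V" "Max (?deg ` V) = ?deg v" by blast
  have max: "?deg u \<le> ?deg v" if "u \<in> V" for u
    using that finite_V v(2) Max_ge[of "?deg ` V" "?deg u"] by simp
  then have "7 \<le> ?deg v" using False by fastforce
  then interpret max_degree_vertex V E v using v(1) max by unfold_locales
  show ?thesis unfolding width_bound_def by (rule layout_width_le_max_degree)
qed

section \<open>Paw-free graphs\<close>

definition paw_free :: "'a set \<Rightarrow> ('a \<Rightarrow> 'a \<Rightarrow> bool) \<Rightarrow> bool" where
  "paw_free V E \<longleftrightarrow> (\<forall>p a b q. {p, a, b, q} \<subseteq> V \<and> E p a \<and> E p b \<and> E a b \<and> E p q \<longrightarrow> E q a \<or> E q b)"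

lemma paw_freeD:
  assumes "paw_free V E" "p \<in> V" "a \<in> V" "b \<in> V" "q \<in> V" "E p a" "E p b" "E a b" "E p q"
  shows "E q a \<or> E q b"
  using assms by (simp add: paw_free_def)

lemma paw_free_subset: "paw_free V E \<Longrightarrow> U \<subseteq> V \<Longrightarrow> paw_free U E"
  unfolding paw_free_def by (meson subset_trans)

locale paw_free_graph_with_triangle = simple_graph +
  assumes paw_free: "paw_free V E" and connected: "graph_connected V E"
    and not_triangle_free: "\<not> triangle_free V E"
begin

lemma edge_in_triangle:
  assumes "u \<in> V" "w \<in> V" "E u w"
  obtains c where "c \<in> V" "E u c" "E w c"
proof -
  define S where "S = {u \<in> V. \<exists>a\<in>V. \<exists>b\<in>V. E u a \<and> E u b \<and> E a b}"
  obtain s where "s \<in> S" using not_triangle_free unfolding S_def triangle_free_def by blast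
  with connected _ have "S = V"
  proof (rule graph_connectedD)
    fix u w assume u: "u \<in> S" and w: "w \<in> V" "E u w"
    then obtain a b where "u \<in> V" "a \<in> V" "b \<in> V" "E u a" "E u b" "E a b" by (auto simp: S_def)
    then show "w \<in> S"
      using paw_freeD[OF paw_free, of u a b w] w adj_commute unfolding S_def by blast
  qed (auto simp: S_def)
  then have "u \<in> S" using assms(1) by simp
  then obtain a b where "a \<in> V" "b \<in> V" "E u a" "E u b" "E a b" by (auto simp: S_def)
  then show ?thesis using paw_freeD[OF paw_free, of u a b w] assms that by blast
qed

lemma nonadj_if_common_nbr_of_edge:
  assumes "w \<in> V" "u \<in> V" "p \<in> V" "y \<in> V" "E w u" "E w p" "E u p" "\<not> E u y" "\<not> E p y"
  shows "\<not> E w y"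
  using paw_freeD[OF paw_free, of w u p y] assms adj_commute by blast

text \<open>Olariu's theorem: non-adjacency is transitive precisely in the complete multipartite graphs.\<close>

lemma nonadj_trans:
  assumes V: "x \<in> V" "y \<in> V" "z \<in> V" and "\<not> E x y" "\<not> E y z"
  shows "\<not> E x z"
proof
  assume "E x z"
  define U where "U = {u \<in> V. \<not> E u y \<and> (\<exists>p\<in>V. E u p \<and> \<not> E p y)}"
  have "x \<in> U" using assms \<open>E x z\<close> adj_commute by (auto simp: U_def)
  with connected _ have "U = V"
  proof (rule graph_connectedD)
    fix u w assume "u \<in> U" and w: "w \<in> V" "E u w"
    then obtain p where p: "u \<in> V" "p \<in> V" "E u p" "\<not> E u y" "\<not> E p y" by (auto simp: U_def)
    obtain c where c: "c \<in> V" "E u c" "E p c" using p(1-3) by (rule edge_in_triangle)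
    then have "\<not> E c y" using nonadj_if_common_nbr_of_edge[of c u p y] p V adj_commute by blast
    have "E w p \<or> E w c" using paw_freeD[OF paw_free, of u p c w] p c w by blast
    then have "\<not> E w y"
      using nonadj_if_common_nbr_of_edge[of w u _ y] p c w V \<open>\<not> E c y\<close> adj_commute by blast
    then show "w \<in> U" using w p adj_commute by (auto simp: U_def)
  qed (auto simp: U_def)
  then have "y \<in> U" using V by blast
  then show False using adj_commute by (auto simp: U_def)
qed

end

lemma layout_width_le_nonadj_trans:
  assumes "finite V" "symp E" "irreflp E"
    and trans: "\<And>x y z. x \<in> V \<Longrightarrow> y \<in> V \<Longrightarrow> z \<in> V \<Longrightarrow> \<not> E x y \<Longrightarrow> \<not> E y z \<Longrightarrow> \<not> E x z"
  shows "layout_width_le V E 1"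
proof (rule layout_width_le_reducible[OF assms(1,2)])
  fix U assume U: "U \<subseteq> V" "U \<noteq> {}" "\<not> reducible U E"
  have sym: "E x y \<longleftrightarrow> E y x" for x y using assms(2) by (metis sympD)
  have no_twins: "\<not> twins U E u w" for u w using U(3) by (auto simp: reducible_def attachable_def)
  have complete: "E u w" if "u \<in> U" "w \<in> U" "u \<noteq> w" for u w
  proof (rule ccontr)
    assume "\<not> E u w"
    then have "E u t \<longleftrightarrow> E w t" if "t \<in> U" for t
      using trans[of u w t] trans[of w u t] sym that \<open>u \<in> U\<close> \<open>w \<in> U\<close> U(1) by blast
    then have "twins U E u w" using \<open>u \<in> U\<close> \<open>w \<in> U\<close> \<open>u \<noteq> w\<close> by (auto simp: twins_def)
    then show False using no_twins by blast
  qed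
  have "u = w" if "u \<in> U" "w \<in> U" for u w
  proof (rule ccontr)
    assume "u \<noteq> w"
    then have "twins U E u w" using complete that by (auto simp: twins_def)
    then show False using no_twins by blast
  qed
  then obtain u where "U = {u}" using U(2) by blast
  then show "layout_width_le U E 1" by simp
qed simp

lemma (in simple_graph) layout_width_le_paw_free:
  assumes "paw_free V E" "p1_chair_free V E"
  shows "layout_width_le V E width_bound"
proof (rule layout_width_le_components[OF finite_V symp_E])
  fix U assume U: "U \<subseteq> V" "graph_connected U E"
  interpret U: simple_graph U E using U(1) by (rule simple_graph_subset)
  show "layout_width_le U E width_bound"
  proof (cases "triangle_free U E")
    case True
    then interpret p1_chair_free_graph U E
      using p1_chair_free_subset[OF assms(2) U(1)] by unfold_locales
    show ?thesis by (rule layout_width_le_triangle_free)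
  next
    case False
    then interpret paw_free_graph_with_triangle U E
      using paw_free_subset[OF assms(1) U(1)] U(2) by unfold_locales
    have "layout_width_le U E 1"
      using U.finite_V symp_E irreflp_E nonadj_trans by (rule layout_width_le_nonadj_trans)
    then show ?thesis by (rule layout_width_le_mono) (simp add: width_bound_def)
  qed
qed

section \<open>Forbidden induced subgraphs\<close>

lemma not_induced_free_if_embedding:
  assumes G: "pair_wf_digraph G" and H: "pair_wf_digraph H"
    and inj: "inj_on f (pverts H)" and sub: "f ` pverts H \<subseteq> pverts G"
    and arcs: "\<And>u w. u \<in> pverts H \<Longrightarrow> w \<in> pverts H \<Longrightarrow> adj G (f u) (f w) \<longleftrightarrow> adj H u w"
  shows "\<not> induced_free H G"
proof -
  interpret G: pair_wf_digraph G by fact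
  interpret H: pair_wf_digraph H by fact
  let ?K = "with_proj G \<restriction> (f ` pverts H)"
  define iso where "iso = \<lparr>iso_verts = f, iso_arcs = map_prod f f, iso_head = snd, iso_tail = fst\<rparr>"
  have in_verts: "u \<in> pverts H \<and> w \<in> pverts H" if "adj H u w" for u w
    using that H.in_arcsD1 H.in_arcsD2 by blast
  have "arcs ?K = map_prod f f ` parcs H"
    using arcs in_verts by (force simp: induce_subgraph_def)
  then have "?K = app_iso iso (with_proj H)"
    by (simp add: app_iso_def iso_def induce_subgraph_def)
  moreover have "pre_digraph.digraph_isomorphism (with_proj H) iso"
    unfolding pre_digraph.digraph_isomorphism_def
  proof (intro conjI)
    show "inj_on (iso_arcs iso) (arcs (with_proj H))"
      using map_prod_inj_on[OF inj inj] in_verts by (auto simp: iso_def intro: inj_on_subset)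
  qed (use inj H.wf_digraph_axioms in \<open>auto simp: iso_def\<close>)
  ultimately have "digraph_iso (with_proj H) ?K" by (auto simp: digraph_iso_def)
  then have "digraph_iso ?K (with_proj H)" by (rule digraph_iso_swap[OF H.wf_digraph_axioms])
  moreover have "induced_subgraph ?K (with_proj G)" using sub by (intro G.induced_induce) simp
  ultimately show ?thesis by (auto simp: induced_free_def)
qed

lemma pverts_disjoint_union: "pverts (disjoint_union G H) = Inl ` pverts G \<union> Inr ` pverts H"
  by (auto simp: disjoint_union_def)

lemma mem_pverts_disjoint_union [simp]:
  "Inl u \<in> pverts (disjoint_union G H) \<longleftrightarrow> u \<in> pverts G"
  "Inr x \<in> pverts (disjoint_union G H) \<longleftrightarrow> x \<in> pverts H"
  by (auto simp: pverts_disjoint_union)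

lemma adj_disjoint_union [simp]:
  "adj (disjoint_union G H) (Inl u) (Inl w) \<longleftrightarrow> adj G u w"
  "adj (disjoint_union G H) (Inr x) (Inr y) \<longleftrightarrow> adj H x y"
  "\<not> adj (disjoint_union G H) (Inl u) (Inr y)"
  "\<not> adj (disjoint_union G H) (Inr x) (Inl w)"
  by (force simp: disjoint_union_def)+

lemma pair_wf_digraph_disjoint_union:
  assumes "pair_wf_digraph G" "pair_wf_digraph H"
  shows "pair_wf_digraph (disjoint_union G H)"
proof -
  interpret G: pair_wf_digraph G by fact
  interpret H: pair_wf_digraph H by fact
  show ?thesis
    by unfold_locales
      (use G.arc_fst_in_verts G.arc_snd_in_verts H.arc_fst_in_verts H.arc_snd_in_verts
        in \<open>force simp: disjoint_union_def\<close>)+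
qed

lemma pverts_graph_complement [simp]: "pverts (graph_complement G) = pverts G"
  by (simp add: graph_complement_def)

lemma adj_graph_complement [simp]:
  "adj (graph_complement G) u w \<longleftrightarrow> u \<in> pverts G \<and> w \<in> pverts G \<and> u \<noteq> w \<and> \<not> adj G u w"
  by (simp add: graph_complement_def)

lemma pair_wf_digraph_graph_complement: "pair_wf_digraph (graph_complement G)"
  by unfold_locales (auto simp: graph_complement_def)

lemma pverts_path_graph [simp]: "pverts (path_graph r) = {..<r}"
  by (simp add: path_graph_def)

lemma adj_path_graph [simp]:
  "adj (path_graph r) u w \<longleftrightarrow> u < r \<and> w < r \<and> (w = Suc u \<or> u = Suc w)"
  by (simp add: path_graph_def)

lemma pair_wf_digraph_path_graph: "pair_wf_digraph (path_graph r)"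
  by unfold_locales (auto simp: path_graph_def)

lemma pverts_S_graph:
  "pverts (S_graph i j k) = {(0, 0)} \<union> {1} \<times> {1..i} \<union> {2} \<times> {1..j} \<union> {3} \<times> {1..k}"
  by (simp add: S_graph_def Let_def)

lemma adj_S_graph:
  "adj (S_graph i j k) (l, m) (l', m') \<longleftrightarrow>
    (l, m) \<in> pverts (S_graph i j k) \<and> (l', m') \<in> pverts (S_graph i j k) \<and>
    (l = 0 \<and> m = 0 \<and> m' = 1 \<or> l = l' \<and> 1 \<le> m \<and> m' = Suc m \<or>
     l' = 0 \<and> m' = 0 \<and> m = 1 \<or> l = l' \<and> 1 \<le> m' \<and> m = Suc m')"
proof -
  let ?E = "{((0, 0), (l, 1)) | l. True} \<union> {((l, d), (l, Suc d)) | l d. 1 \<le> d}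
    :: ((nat \<times> nat) \<times> (nat \<times> nat)) set"
  have "((l, m), (l', m')) \<in> ?E \<union> ?E\<inverse> \<longleftrightarrow>
    (l = 0 \<and> m = 0 \<and> m' = 1 \<or> l = l' \<and> 1 \<le> m \<and> m' = Suc m \<or>
     l' = 0 \<and> m' = 0 \<and> m = 1 \<or> l = l' \<and> 1 \<le> m' \<and> m = Suc m')"
    by auto
  moreover have "parcs (S_graph i j k) =
      (?E \<union> ?E\<inverse>) \<inter> pverts (S_graph i j k) \<times> pverts (S_graph i j k)"
    by (simp only: S_graph_def Let_def pair_pre_digraph.select_convs)
  ultimately show ?thesis by (simp only: Int_iff mem_Sigma_iff conj_ac)
qed

lemma pair_wf_digraph_S_graph: "pair_wf_digraph (S_graph i j k)"
  by unfold_locales (auto simp: S_graph_def Let_def)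

lemma pverts_S_graph_112: "pverts (S_graph 1 1 2) = {(0, 0), (1, 1), (2, 1), (3, 1), (3, 2)}"
proof -
  have "{1..2::nat} = {1, 2}" by auto
  then show ?thesis by (auto simp: pverts_S_graph)
qed

lemma simple_graph_if_pair_graph:
  assumes "pair_graph G"
  shows "simple_graph (pverts G) (adj G)"
proof -
  interpret pair_graph G by fact
  show ?thesis using pair_finite_verts pair_graph_adj[OF assms] by unfold_locales
qed

lemma paw_free_if_induced_free:
  assumes G: "pair_graph G"
    and free: "induced_free (graph_complement (disjoint_union (path_graph 1) (path_graph 3))) G"
  shows "paw_free (pverts G) (adj G)"
  unfolding paw_free_def
proof (intro allI impI, rule ccontr)
  let ?H = "graph_complement (disjoint_union (path_graph 1) (path_graph 3))"
  interpret pair_graph G by fact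
  interpret simple_graph "pverts G" "adj G" using G by (rule simple_graph_if_pair_graph)
  fix p a b q
  assume paw: "{p, a, b, q} \<subseteq> pverts G \<and> adj G p a \<and> adj G p b \<and> adj G a b \<and> adj G p q"
    and "\<not> (adj G q a \<or> adj G q b)"
  then have adj: "adj G a p" "adj G b p" "adj G b a" "adj G q p"
    and nadj: "\<not> adj G q a" "\<not> adj G q b" "\<not> adj G a q" "\<not> adj G b q"
    using adj_commute by blast+
  have distinct: "distinct [p, a, q, b]" using paw adj nadj not_adj_self by auto
  define f :: "nat + nat \<Rightarrow> 'a" where "f = case_sum (\<lambda>_. p) ((!) [a, q, b])"
  have "{..<3::nat} = {0, 1, 2}" by auto
  then have verts: "pverts ?H = {Inl 0, Inr 0, Inr 1, Inr 2}" by (auto simp: pverts_disjoint_union)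
  have "\<not> induced_free ?H G"
  proof (rule not_induced_free_if_embedding[where f = f])
    show "inj_on f (pverts ?H)" unfolding verts using distinct by (simp add: f_def)
    show "f ` pverts ?H \<subseteq> pverts G" unfolding verts using paw by (simp add: f_def)
    fix u w assume "u \<in> pverts ?H" "w \<in> pverts ?H"
    then show "adj G (f u) (f w) \<longleftrightarrow> adj ?H u w"
      unfolding verts by (elim insertE emptyE) (simp_all add: f_def paw adj nadj)
  qed (rule pair_wf_digraph_axioms pair_wf_digraph_graph_complement)+
  then show False using free by blast
qed

lemma p1_chair_free_if_induced_free:
  assumes G: "pair_graph G"
    and free: "induced_free (disjoint_union (path_graph 1) (S_graph 1 1 2)) G"
  shows "p1_chair_free (pverts G) (adj G)"
  unfolding p1_chair_free_def
proof (intro allI impI, rule ccontr)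
  let ?H = "disjoint_union (path_graph 1) (S_graph 1 1 2)"
  interpret pair_graph G by fact
  interpret simple_graph "pverts G" "adj G" using G by (rule simple_graph_if_pair_graph)
  fix z x a b c d
  assume V: "{z, x, a, b, c, d} \<subseteq> pverts G \<and> chair (adj G) x a b c d"
    and "\<not> (adj G z x \<or> adj G z a \<or> adj G z b \<or> adj G z c \<or> adj G z d)"
  then have adj: "adj G x a" "adj G x b" "adj G x c" "adj G c d" "a \<noteq> b"
    and nadj: "\<not> adj G a b" "\<not> adj G a c" "\<not> adj G b c" "\<not> adj G x d" "\<not> adj G a d" "\<not> adj G b d"
      "\<not> adj G z x" "\<not> adj G z a" "\<not> adj G z b" "\<not> adj G z c" "\<not> adj G z d"
    by (simp_all add: chair_def)
  have adj': "adj G a x" "adj G b x" "adj G c x" "adj G d c" using adj adj_commute by blast+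
  have nadj': "\<not> adj G b a" "\<not> adj G c a" "\<not> adj G c b" "\<not> adj G d x" "\<not> adj G d a" "\<not> adj G d b"
      "\<not> adj G x z" "\<not> adj G a z" "\<not> adj G b z" "\<not> adj G c z" "\<not> adj G d z"
    using nadj adj_commute by blast+
  have distinct: "distinct [z, x, a, b, c, d]"
    using adj nadj adj' nadj' by auto
  define f :: "nat + nat \<times> nat \<Rightarrow> 'a"
    where "f = case_sum (\<lambda>_. z) (\<lambda>(l, i). [x, a, b, if i = 1 then c else d] ! l)"
  have verts: "pverts ?H = {Inl 0, Inr (0, 0), Inr (1, 1), Inr (2, 1), Inr (3, 1), Inr (3, 2)}"
    unfolding pverts_disjoint_union pverts_S_graph_112 by auto
  have "\<not> induced_free ?H G"
  proof (rule not_induced_free_if_embedding[where f = f])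
    show "inj_on f (pverts ?H)" unfolding verts using distinct by (simp add: f_def numeral_3_eq_3)
    show "f ` pverts ?H \<subseteq> pverts G" unfolding verts using V by (simp add: f_def)
    fix u w assume "u \<in> pverts ?H" "w \<in> pverts ?H"
    then show "adj G (f u) (f w) \<longleftrightarrow> adj ?H u w"
      unfolding verts
      by (elim insertE emptyE)
        (simp_all add: f_def adj_S_graph pverts_S_graph_112 adj nadj adj' nadj' del: One_nat_def)
  qed (intro pair_wf_digraph_axioms pair_wf_digraph_disjoint_union pair_wf_digraph_path_graph
      pair_wf_digraph_S_graph)+
  then show False using free by blast
qed

theorem theorem1:
  shows "bounded_clique_width
    {G :: 'a pair_pre_digraph. pair_graph G \<and>
       induced_free (graph_complement (disjoint_union (path_graph 1) (path_graph 3))) G \<and>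
       induced_free (disjoint_union (path_graph 1) (S_graph 1 1 2)) G}"
  unfolding bounded_clique_width_def
proof (intro exI ballI)
  fix G :: "'a pair_pre_digraph"
  assume "G \<in> {G. pair_graph G \<and>
       induced_free (graph_complement (disjoint_union (path_graph 1) (path_graph 3))) G \<and>
       induced_free (disjoint_union (path_graph 1) (S_graph 1 1 2)) G}"
  then have G: "pair_graph G" and "paw_free (pverts G) (adj G)" "p1_chair_free (pverts G) (adj G)"
    using paw_free_if_induced_free p1_chair_free_if_induced_free by auto
  interpret simple_graph "pverts G" "adj G" using G by (rule simple_graph_if_pair_graph)
  have "layout_width_le (pverts G) (adj G) width_bound"
    by (rule layout_width_le_paw_free) fact+
  with G show "clique_width G \<le> 4 * (width_bound + 1)"
    by (rule clique_width_le_if_layout_width_le)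
qed

end
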